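(* Let $(A_0,A_1)$ be a compatible pair of Banach spaces and put $\vec X=(A_1,A_0)$. Let $\Pi$ be a bilinear operator that is bounded $$\Pi: A_0\times A_0\to A_0,\qquad \Pi: A_0\times A_1\to A_1,\qquad \Pi: A_1\times A_0\to A_1.$$ Let $1<p<\infty$ and $\theta=\frac1p$. Then there is a constant $C>0$, independent of $f$ and $g$, such that for all $f,g\in \vec X_{1-\theta,p}$ with $\|f\|_{\vec X^{(1)}_{1,\infty}}<\infty$ and $\|g\|_{\vec X^{(1)}_{1,\infty}}<\infty$, $$\|\Pi(f,g)\|_{\vec X_{1-\theta,p}}\le C\left(\|f\|_{\vec X_{1-\theta,p}}\|g\|_{\vec X^{(1)}_{1,\infty}}+\|g\|_{\vec X_{1-\theta,p}}\|f\|_{\vec X^{(1)}_{1,\infty}}\right).$$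
   Context: For a compatible pair of Banach spaces $\vec X=(X_0,X_1)$ (both continuously embedded in a common Hausdorff topological vector space), $f\in X_0+X_1$ and $t>0$, the $K$-functional is $$K(t,f;\vec X)=\inf\{\|f_0\|_{X_0}+t\|f_1\|_{X_1}: f=f_0+f_1,\ f_i\in X_i\}.$$ It is concave in $t$; $K'(t,f;\vec X)$ denotes its $t$-derivative, which exists for almost every $t$. Here $\vec X=(A_1,A_0)$, i.e. $X_0=A_1$ and $X_1=A_0$. For $0<\eta<1$ and $1\le q<\infty$, the Lions–Peetre real interpolation space $\vec X_{\eta,q}$ is the set of $f\in X_0+X_1$ for which $$\|f\|_{\vec X_{\eta,q}}=\left\{\int_0^\infty\left[t^{-\eta}K(t,f;\vec X)\right]^q\frac{dt}{t}\right\}^{1/q}<\infty.$$ Also (not a norm in general) $$\|f\|_{\vec X^{(1)}_{1,\infty}}=\sup_{t>0}\left[\frac{K(t,f;\vec X)}{t}-K'(t,f;\vec X)\right],$$ the supremum being over those $t$ at which $K'$ exists. On interpolation spaces, $\Pi$ denotes the bounded bilinear operator $\vec X_{1-\frac{\theta}{2},2p}\times\vec X_{1-\frac{\theta}{2},2p}\to\vec X_{1-\theta,p}$ obtained by continuously extending $\Pi$ from $(A_0\cap A_1)\times(A_0\cap A_1)$ (which is dense); the existence of this extension is O'Neil's classical bilinear real interpolation theorem. The model case is $A_0=L^\infty$, $A_1=L^1$, $\Pi(f,g)=fg$. *)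

theory Defs
  imports "HOL-Analysis.Analysis"
begin

class hausdorff_tvs = real_vector + topological_ab_group_add + t2_space +
  assumes tendsto_scaleR_Pair:
    "filterlim (\<lambda>z. fst z *\<^sub>R snd z) (nhds (c *\<^sub>R x)) (nhds c \<times>\<^sub>F nhds x)"

text \<open>
  The two spaces of a couple are Banach space types, each placed in a common Hausdorff
  topological vector space by a continuous injective linear map; the elements of the spaces,
  of their intersection and of their sum are then vectors of the ambient space.
\<close>

definition continuous_embedding ::
    "('a::real_normed_vector \<Rightarrow> 'v::hausdorff_tvs) \<Rightarrow> bool" where
  "continuous_embedding e \<longleftrightarrow> linear e \<and> inj e \<and> continuous_on UNIV e"

definition compatible_couple ::
    "('a::banach \<Rightarrow> 'v::hausdorff_tvs) \<Rightarrow> ('b::banach \<Rightarrow> 'v) \<Rightarrow> bool" where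
  "compatible_couple e0 e1 \<longleftrightarrow> continuous_embedding e0 \<and> continuous_embedding e1"

definition couple_sum ::
    "('a::banach \<Rightarrow> 'v::hausdorff_tvs) \<Rightarrow> ('b::banach \<Rightarrow> 'v) \<Rightarrow> 'v set" where
  "couple_sum e0 e1 = {e0 x + e1 y |x y. True}"

definition couple_inter ::
    "('a::banach \<Rightarrow> 'v::hausdorff_tvs) \<Rightarrow> ('b::banach \<Rightarrow> 'v) \<Rightarrow> 'v set" where
  "couple_inter e0 e1 = range e0 \<inter> range e1"

definition K_functional ::
    "('a::banach \<Rightarrow> 'v::hausdorff_tvs) \<Rightarrow> ('b::banach \<Rightarrow> 'v) \<Rightarrow> real \<Rightarrow> 'v \<Rightarrow> real" where
  "K_functional e0 e1 t f = Inf {norm x + t * norm y |x y. f = e0 x + e1 y}"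

definition ennreal_powr :: "ennreal \<Rightarrow> real \<Rightarrow> ennreal" where
  "ennreal_powr x a = (if x = \<infinity> then \<infinity> else ennreal (enn2real x powr a))"

text \<open>
  Norms take values in the extended nonnegative reals. Outside the sum of the couple the
  K-functional is an infimum over the empty set, so the norm is set to infinity there.
\<close>

definition interp_norm ::
    "('a::banach \<Rightarrow> 'v::hausdorff_tvs) \<Rightarrow> ('b::banach \<Rightarrow> 'v) \<Rightarrow> real \<Rightarrow> real \<Rightarrow> 'v \<Rightarrow> ennreal" where
  "interp_norm e0 e1 \<eta> q f =
     (if f \<in> couple_sum e0 e1
      then ennreal_powr
             (\<integral>\<^sup>+t\<in>{0<..}. ennreal ((t powr (- \<eta>) * K_functional e0 e1 t f) powr q / t) \<partial>lborel)
             (1 / q)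
      else \<infinity>)"

definition interp_space ::
    "('a::banach \<Rightarrow> 'v::hausdorff_tvs) \<Rightarrow> ('b::banach \<Rightarrow> 'v) \<Rightarrow> real \<Rightarrow> real \<Rightarrow> 'v set" where
  "interp_space e0 e1 \<eta> q = {f \<in> couple_sum e0 e1. interp_norm e0 e1 \<eta> q f < \<infinity>}"

text \<open>
  By concavity of the K-functional, the differences below are nonnegative for \<open>f\<close> in the sum,
  so nothing is lost by the conversion to extended nonnegative reals.
\<close>

definition weak_limit_norm ::
    "('a::banach \<Rightarrow> 'v::hausdorff_tvs) \<Rightarrow> ('b::banach \<Rightarrow> 'v) \<Rightarrow> 'v \<Rightarrow> ennreal" where
  "weak_limit_norm e0 e1 f =
     (if f \<in> couple_sum e0 e1
      then (SUP t\<in>{t. 0 < t \<and> (\<lambda>s. K_functional e0 e1 s f) differentiable (at t)}.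
              ennreal (K_functional e0 e1 t f / t - deriv (\<lambda>s. K_functional e0 e1 s f) t))
      else \<infinity>)"

text \<open>
  \<open>bounded_bilinear_between e e' e'' B\<close>: the restriction of \<open>B\<close> to the first two embedded
  spaces is a bounded bilinear map into the third. The values of \<open>B\<close> elsewhere are arbitrary;
  using one \<open>B\<close> for several triples makes the maps agree on the overlaps.
\<close>

definition bounded_bilinear_between ::
    "('a::real_normed_vector \<Rightarrow> 'v) \<Rightarrow> ('b::real_normed_vector \<Rightarrow> 'v) \<Rightarrow>
     ('c::real_normed_vector \<Rightarrow> 'v) \<Rightarrow> ('v \<Rightarrow> 'v \<Rightarrow> 'v) \<Rightarrow> bool" where
  "bounded_bilinear_between e e' e'' B \<longleftrightarrow>
     (\<exists>b. bounded_bilinear b \<and> (\<forall>x y. B (e x) (e' y) = e'' (b x y)))"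

definition bounded_bilinear_on ::
    "'v::real_vector set \<Rightarrow> ('v \<Rightarrow> ennreal) \<Rightarrow> 'v set \<Rightarrow> ('v \<Rightarrow> ennreal) \<Rightarrow> ('v \<Rightarrow> 'v \<Rightarrow> 'v) \<Rightarrow> bool" where
  "bounded_bilinear_on X N Y N' T \<longleftrightarrow>
     (\<forall>f\<in>X. \<forall>g\<in>X. T f g \<in> Y) \<and>
     (\<forall>f\<in>X. \<forall>f'\<in>X. \<forall>g\<in>X. \<forall>a b. T (a *\<^sub>R f + b *\<^sub>R f') g = a *\<^sub>R T f g + b *\<^sub>R T f' g) \<and>
     (\<forall>f\<in>X. \<forall>g\<in>X. \<forall>g'\<in>X. \<forall>a b. T f (a *\<^sub>R g + b *\<^sub>R g') = a *\<^sub>R T f g + b *\<^sub>R T f g') \<and>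
     (\<exists>M\<ge>0. \<forall>f\<in>X. \<forall>g\<in>X. N' (T f g) \<le> ennreal M * N f * N g)"

text \<open>
  The bounded bilinear extension of \<open>B\<close> from the intersection of the couple to the
  interpolation space with parameters \<open>\<eta>, q\<close>, with values in the one with parameters
  \<open>\<eta>', q'\<close>. Where such an extension exists it is unique on that space, since the intersection
  is dense; the choice operator only fixes the irrelevant values outside of it.
\<close>

definition interp_extension ::
    "('a::banach \<Rightarrow> 'v::hausdorff_tvs) \<Rightarrow> ('b::banach \<Rightarrow> 'v) \<Rightarrow> real \<Rightarrow> real \<Rightarrow> real \<Rightarrow> real \<Rightarrow>
     ('v \<Rightarrow> 'v \<Rightarrow> 'v) \<Rightarrow> 'v \<Rightarrow> 'v \<Rightarrow> 'v" where
  "interp_extension e0 e1 \<eta> q \<eta>' q' B =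
     (SOME T. bounded_bilinear_on (interp_space e0 e1 \<eta> q) (interp_norm e0 e1 \<eta> q)
                (interp_space e0 e1 \<eta>' q') (interp_norm e0 e1 \<eta>' q') T \<and>
              (\<forall>f\<in>couple_inter e0 e1. \<forall>g\<in>couple_inter e0 e1. T f g = B f g))"

end

theory Submission
  imports Defs
begin

text \<open>
  Write \<open>\<phi>\<^sub>f t = K(t, f) / t\<close>, the function \<open>K_mean\<close> below. At \<open>\<eta> = 1 - 1 / q\<close> the interpolation norm is the
  \<open>L\<^sup>q\<close> norm of \<open>\<phi>\<^sub>f\<close>, so the estimate asked for is a product estimate with target exponent \<open>p\<close>, for an
  operator that is bounded on pairs of exponent \<open>2 * p\<close>. The proof has two independent halves.

  The first half (\<open>interp_norm_weak_le\<close>) is an interpolation inequality: the norm of exponent \<open>2 * p\<close> is at most a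
  constant times the square root of the norm of exponent \<open>p\<close> times the weak-type functional. Since
  \<open>\<phi>\<^sub>f' = - (K / t - K') / t\<close>, a bound \<open>w\<close> on that functional means that \<open>\<phi>\<^sub>f\<close> grows at most like \<open>w * ln (1 / t)\<close> towards \<open>0\<close>
  (\<open>concave_quotient_log_growth\<close>), and cutting \<open>\<phi>\<^sub>f\<close> at height \<open>w\<close> gives the inequality
  (\<open>log_growth_integral_le\<close>).

  The second half is O'Neil's theorem. A vector \<open>f\<close> is decomposed at the scales \<open>2 powr (- k)\<close> as
  \<open>f = e1 (a k) + e0 (b k)\<close>, nearly optimally for the K-functional. The products \<open>b00 (b k) (b' k)\<close> of the parts in
  the space embedded by \<open>e0\<close> converge in the ambient space, because successive differences only involve products of one
  small factor \<open>a k - a (Suc k)\<close> with one factor \<open>b' k\<close>, for which the operator is bounded. This limit is the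
  bounded bilinear extension; its K-functional is controlled by a dyadic average of \<open>\<phi>\<^sub>f * \<phi>\<^sub>g\<close>
  (\<open>product_K_functional_le\<close>), and Hardy's and Schwarz's inequalities bound its norm (\<open>product_norm_bound\<close>).

  Combining the halves, the product has norm at most a constant times the geometric mean of the two summands on
  the right-hand side, and the arithmetic-geometric mean inequality concludes.
\<close>

section \<open>K-functionals\<close>

lemma K_functional_le:
  assumes "0 \<le> t" "f = e0 x + e1 y"
  shows "K_functional e0 e1 t f \<le> norm x + t * norm y"
  unfolding K_functional_def using assms
  by (intro cInf_lower bdd_belowI[of _ 0]) auto

lemma K_functional_greatest:
  assumes "f \<in> couple_sum e0 e1"
    and "\<And>x y. f = e0 x + e1 y \<Longrightarrow> c \<le> norm x + t * norm y"
  shows "c \<le> K_functional e0 e1 t f"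
  unfolding K_functional_def using assms
  by (intro cInf_greatest) (auto simp: couple_sum_def)

lemma K_functional_nonneg:
  assumes "f \<in> couple_sum e0 e1" "0 \<le> t"
  shows "0 \<le> K_functional e0 e1 t f"
  using assms by (intro K_functional_greatest) auto

lemma K_functional_mono:
  assumes "f \<in> couple_sum e0 e1" "0 \<le> s" "s \<le> t"
  shows "K_functional e0 e1 s f \<le> K_functional e0 e1 t f"
proof (rule K_functional_greatest[OF assms(1)])
  fix x y assume "f = e0 x + e1 y"
  from K_functional_le[of s f e0 x e1 y, OF assms(2) this] show "K_functional e0 e1 s f \<le> norm x + t * norm y"
    using mult_right_mono[OF assms(3), of "norm y"] by simp
qed

lemma K_functional_div_antimono:
  assumes "f \<in> couple_sum e0 e1" "0 < s" "s \<le> t"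
  shows "K_functional e0 e1 t f / t \<le> K_functional e0 e1 s f / s"
proof -
  have "s / t * K_functional e0 e1 t f \<le> K_functional e0 e1 s f"
  proof (rule K_functional_greatest[OF assms(1)])
    fix x y assume f: "f = e0 x + e1 y"
    have "s / t * K_functional e0 e1 t f \<le> s / t * (norm x + t * norm y)"
      using assms f by (intro mult_left_mono K_functional_le) auto
    also have "\<dots> = s / t * norm x + s * norm y"
      using assms by (simp add: field_simps)
    also have "\<dots> \<le> 1 * norm x + s * norm y"
      using assms by (intro add_right_mono mult_right_mono) auto
    finally show "s / t * K_functional e0 e1 t f \<le> norm x + s * norm y" by simp
  qed
  then show ?thesis using assms by (simp add: field_simps)
qed

text \<open>
  An infimum of affine functions of \<open>t\<close>.
\<close>
lemma K_functional_concave: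
  assumes "f \<in> couple_sum e0 e1"
  shows "concave_on {0<..} (\<lambda>t. K_functional e0 e1 t f)"
  unfolding concave_on_iff
proof (intro conjI ballI allI impI convex_real_interval)
  fix s t u v :: real
  assume st: "s \<in> {0<..}" "t \<in> {0<..}" and uv: "0 \<le> u" "0 \<le> v" "u + v = 1"
  show "u * K_functional e0 e1 s f + v * K_functional e0 e1 t f
      \<le> K_functional e0 e1 (u *\<^sub>R s + v *\<^sub>R t) f"
  proof (rule K_functional_greatest[OF assms])
    fix x y assume f: "f = e0 x + e1 y"
    have "u * K_functional e0 e1 s f + v * K_functional e0 e1 t f
        \<le> u * (norm x + s * norm y) + v * (norm x + t * norm y)"
      using st uv f by (intro add_mono mult_left_mono K_functional_le) auto
    also have "\<dots> = (u + v) * norm x + (u * s + v * t) * norm y"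
      by (simp add: algebra_simps)
    finally show "u * K_functional e0 e1 s f + v * K_functional e0 e1 t f
        \<le> norm x + (u *\<^sub>R s + v *\<^sub>R t) * norm y"
      using uv by simp
  qed
qed

lemma K_functional_approx:
  assumes "f \<in> couple_sum e0 e1" "K_functional e0 e1 t f < c"
  obtains x y where "f = e0 x + e1 y" "norm x + t * norm y < c"
  using assms K_functional_greatest[OF assms(1), of c t] by fastforce

lemma compatible_coupleD:
  assumes "compatible_couple e0 e1"
  shows "linear e0" "linear e1" "continuous_on UNIV e0" "continuous_on UNIV e1"
  using assms by (simp_all add: compatible_couple_def continuous_embedding_def)

lemma compatible_couple_isCont:
  assumes "compatible_couple e0 e1"
  shows "isCont e0 x" "isCont e1 y"
  using compatible_coupleD[OF assms] continuous_on_interior[of UNIV e0 x]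
    continuous_on_interior[of UNIV e1 y] by simp_all

lemma K_functional_eq_0:
  assumes "compatible_couple e0 e1" "f \<in> couple_sum e0 e1" "0 < t" "K_functional e0 e1 t f = 0"
  shows "f = 0"
proof -
  let ?r = "\<lambda>n. inverse (real (Suc n))"
  \<comment> \<open>Decompositions of vanishing cost tend to \<open>0 + 0\<close>, while their sum is always \<open>f\<close>.\<close>
  have "\<exists>z. f = e0 (fst z) + e1 (snd z) \<and> norm (fst z) + t * norm (snd z) < ?r n" for n
    using K_functional_approx[OF assms(2), of t "?r n"] assms(4) by fastforce
  then obtain z where z: "\<And>n. f = e0 (fst (z n)) + e1 (snd (z n))"
      "\<And>n. norm (fst (z n)) + t * norm (snd (z n)) < ?r n"
    by metis
  have bound: "norm (fst (z n)) \<le> ?r n" "norm (snd (z n)) \<le> ?r n / t" for n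
  proof -
    have "0 \<le> t * norm (snd (z n))" using assms(3) by simp
    then show "norm (fst (z n)) \<le> ?r n" using z(2)[of n] by linarith
    have "t * norm (snd (z n)) \<le> ?r n" using z(2)[of n] norm_ge_zero[of "fst (z n)"] by linarith
    then show "norm (snd (z n)) \<le> ?r n / t"
      using assms(3) by (subst pos_le_divide_eq) (simp_all only: mult.commute)
  qed
  have "(\<lambda>n. fst (z n)) \<longlonglongrightarrow> 0"
    by (rule Lim_null_comparison[OF always_eventually LIMSEQ_inverse_real_of_nat]) (rule allI bound)+
  moreover have "(\<lambda>n. ?r n / t) \<longlonglongrightarrow> 0"
    by (rule tendsto_divide_zero[OF LIMSEQ_inverse_real_of_nat])
  then have "(\<lambda>n. snd (z n)) \<longlonglongrightarrow> 0"
    by (rule Lim_null_comparison[OF always_eventually, rotated]) (rule allI bound)+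
  ultimately have lim: "(\<lambda>n. fst (z n)) \<longlonglongrightarrow> 0" "(\<lambda>n. snd (z n)) \<longlonglongrightarrow> 0" .
  have "(\<lambda>n. e0 (fst (z n)) + e1 (snd (z n))) \<longlonglongrightarrow> e0 0 + e1 0"
    using isCont_tendsto_compose[OF compatible_couple_isCont(1)[OF assms(1)] lim(1)]
      isCont_tendsto_compose[OF compatible_couple_isCont(2)[OF assms(1)] lim(2)]
    by (rule tendsto_add)
  moreover have "e0 0 = 0" "e1 0 = 0"
    using compatible_coupleD[OF assms(1)] linear_0 by blast+
  ultimately have "(\<lambda>n. f) \<longlonglongrightarrow> 0"
    unfolding z(1)[symmetric] by simp
  then show "f = 0" using LIMSEQ_unique[OF tendsto_const] by blast
qed

text \<open>
  The factor \<open>2\<close> leaves room for a near-minimiser when the K-functional is positive; when it vanishes,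
  \<open>f = 0\<close> and the trivial decomposition serves.
\<close>
lemma K_functional_near_minimiser:
  assumes "compatible_couple e0 e1" "f \<in> couple_sum e0 e1" "0 < t"
  obtains x y where "f = e0 x + e1 y" "norm x \<le> 2 * K_functional e0 e1 t f"
    "t * norm y \<le> 2 * K_functional e0 e1 t f"
proof (cases "K_functional e0 e1 t f = 0")
  case True
  then have "f = 0" using K_functional_eq_0 assms by blast
  moreover have "e0 0 = 0" "e1 0 = 0"
    using compatible_coupleD[OF assms(1)] linear_0 by blast+
  ultimately show ?thesis using that[of 0 0] True by simp
next
  case False
  then have "0 < K_functional e0 e1 t f" 
    using K_functional_nonneg[OF assms(2), of t] assms(3) by simp
  then obtain x y where "f = e0 x + e1 y" "norm x + t * norm y < 2 * K_functional e0 e1 t f"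
    using K_functional_approx[OF assms(2), of t "2 * K_functional e0 e1 t f"] by auto
  moreover have "0 \<le> t * norm y" using assms(3) by simp
  ultimately show ?thesis using that[of x y] norm_ge_zero[of x] by linarith
qed

section \<open>Concave functions away from their corners\<close>

text \<open>
  The mean value theorem with a countable exceptional set. Differentiability points
  are all that the weak-type functional sees, so this is how it controls the K-functional between them.
\<close>
lemma nondecreasing_except_countable:
  fixes G G' :: "real \<Rightarrow> real"
  assumes "a \<le> b" "continuous_on {a..b} G" "countable D"
    and deriv: "\<And>x. x \<in> {a..b} - D \<Longrightarrow> (G has_real_derivative G' x) (at x)"
    and nonneg: "\<And>x. x \<in> {a..b} - D \<Longrightarrow> 0 \<le> G' x"
  shows "G a \<le> G b"
proof (rule field_le_epsilon)
  fix \<epsilon> :: real assume "0 < \<epsilon>"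
  \<comment> \<open>The slope \<open>d\<close> makes the derivative strictly positive and costs at most \<open>\<epsilon>\<close> over the interval.\<close>
  define d where "d = \<epsilon> / (b - a + 1)"
  have d: "0 < d" "d * (b - a) \<le> \<epsilon>"
    using \<open>0 < \<epsilon>\<close> \<open>a \<le> b\<close> by (auto simp: d_def field_simps)
  define H where "H = (\<lambda>x. G x + d * x)"
  have contH: "continuous_on {a..b} H"
    unfolding H_def by (intro continuous_intros assms)
  have derivH: "(H has_real_derivative G' x + d) (at x)" if "x \<in> {a..b} - D" for x
    unfolding H_def by (auto intro!: derivative_eq_intros deriv[OF that])
  have "H a \<le> H b"
  proof (rule ccontr)
    assume "\<not> H a \<le> H b"
    then have "uncountable {H b<..<H a}" by (simp add: uncountable_open_interval)
    \<comment> \<open>A level avoiding the values of \<open>H\<close> on \<open>D\<close> is last attained at a point of differentiability,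
      past which \<open>H\<close> would have to stay below that level although its derivative is positive.\<close>
    then have "\<not> {H b<..<H a} \<subseteq> H ` D"
      using countable_subset[OF _ countable_image[OF \<open>countable D\<close>, of H]] by blast
    then obtain y where "y \<in> {H b<..<H a}" and "y \<notin> H ` D" unfolding subset_iff by blast
    then have y: "H b < y" "y < H a" "y \<notin> H ` D" by simp_all
    define S where "S = {x \<in> {a..b}. y \<le> H x}"
    have "compact S"
    proof -
      have "S = {a..b} \<inter> H -` {y..}" by (auto simp: S_def)
      then have "closed S"
        using continuous_closed_preimage[OF contH closed_atLeastAtMost closed_atLeast] by simp
      moreover have "bounded S" unfolding S_def by (rule bounded_subset[of "{a..b}"]) auto
      ultimately show ?thesis by (simp add: compact_eq_bounded_closed)
    qed
    have "a \<in> S" using y \<open>a \<le> b\<close> by (auto simp: S_def)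
    then obtain x where x: "x \<in> S" "\<And>z. z \<in> S \<Longrightarrow> z \<le> x"
      using compact_attains_sup[OF \<open>compact S\<close>] by blast
    have "x < b" using x(1) y(1) by (cases "x = b") (auto simp: S_def)
    have "H x = y"
    proof (rule ccontr)
      assume "H x \<noteq> y"
      then have "y < H x" using x(1) by (auto simp: S_def)
      have "\<exists>z\<ge>x. z \<le> b \<and> H z = y"
        using x(1) \<open>x < b\<close> \<open>y < H x\<close> y(1)
        by (intro IVT2' continuous_on_subset[OF contH]) (auto simp: S_def)
      then obtain z where "x \<le> z" "z \<le> b" "H z = y" by blast
      moreover have "z \<in> S" using calculation x(1) by (auto simp: S_def)
      ultimately show False using x(2)[of z] \<open>y < H x\<close> by simp
    qed
    then have "x \<in> {a..b} - D" using x(1) y(3) by (auto simp: S_def)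
    then obtain e where e: "0 < e" "\<And>h. 0 < h \<Longrightarrow> h < e \<Longrightarrow> H x < H (x + h)"
      using DERIV_pos_inc_right[OF derivH] nonneg d(1) by (metis add_nonneg_pos)
    define h where "h = min (e / 2) (b - x)"
    have "0 < h" "h < e" "x + h \<le> b" using e(1) \<open>x < b\<close> by (auto simp: h_def)
    then have "x + h \<in> S" using e(2)[of h] \<open>H x = y\<close> x(1) by (auto simp: S_def)
    then show False using x(2) \<open>0 < h\<close> by force
  qed
  then show "G a \<le> G b + \<epsilon>" using d by (simp add: H_def algebra_simps)
qed

text \<open>
  Subgradients increase with the base point, hence jump only countably often, and
  difference quotients are squeezed between subgradients.
\<close>
lemma convex_on_countable_not_differentiable:
  fixes f :: "real \<Rightarrow> real"
  assumes "convex_on S f" "open S"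
  shows "countable {t \<in> S. \<not> f differentiable (at t)}"
proof -
  \<comment> \<open>A monotone selection of subgradients; \<open>f\<close> is differentiable wherever it is continuous.\<close>
  define d where "d x = Inf ((\<lambda>t. (f x - f t) / (x - t)) ` ({x<..} \<inter> S))" for x
  have sub: "f x + d x * (y - x) \<le> f y" if "x \<in> S" "y \<in> S" for x y
    unfolding d_def
    using convex_le_Inf_differential[OF assms(1)] that \<open>open S\<close> by (simp add: interior_open)
  have "mono_on S d"
  proof (rule mono_onI)
    fix x y assume xy: "x \<in> S" "y \<in> S" "x \<le> y"
    have "(d y - d x) * (y - x) \<ge> 0"
      using sub[OF xy(1,2)] sub[OF xy(2,1)] by (simp add: algebra_simps)
    then show "d x \<le> d y"
      using xy by (cases "x = y") (auto simp: zero_le_mult_iff)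
  qed
  then have "countable {t \<in> S. \<not> isCont d t}"
    using \<open>open S\<close> by (rule mono_on_ctble_discont_open[rotated])
  moreover have "f differentiable (at t)" if t: "t \<in> S" "isCont d t" for t
  proof -
    have "((\<lambda>s. (f s - f t) / (s - t)) \<longlongrightarrow> d t) (at t)"
    proof (rule tendsto_sandwich)
      have "eventually (\<lambda>s. s \<in> S \<and> s \<noteq> t) (at t)"
        using \<open>open S\<close> t by (auto simp: eventually_at_topological)
      then show "\<forall>\<^sub>F s in at t. min (d t) (d s) \<le> (f s - f t) / (s - t)"
      proof eventually_elim
        case (elim s)
        then show ?case
          using sub[of s t] sub[of t s] t by (cases "s < t") (auto simp: field_simps min_le_iff_disj)
      qed
      from \<open>eventually (\<lambda>s. s \<in> S \<and> s \<noteq> t) (at t)\<close>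
      show "\<forall>\<^sub>F s in at t. (f s - f t) / (s - t) \<le> max (d t) (d s)"
      proof eventually_elim
        case (elim s)
        then show ?case
          using sub[of s t] sub[of t s] t by (cases "s < t") (auto simp: field_simps le_max_iff_disj)
      qed
      have "(d \<longlongrightarrow> d t) (at t)" using t(2) by (simp add: isCont_def)
      then show "((\<lambda>s. min (d t) (d s)) \<longlongrightarrow> d t) (at t)" "((\<lambda>s. max (d t) (d s)) \<longlongrightarrow> d t) (at t)"
        using tendsto_min[OF tendsto_const, of d "d t" "at t" "d t"]
          tendsto_max[OF tendsto_const, of d "d t" "at t" "d t"] by auto
    qed
    then have "(f has_real_derivative d t) (at t)"
      by (simp add: has_field_derivative_iff)
    then show ?thesis using differentiableI has_field_derivative_def by blast
  qed
  ultimately show ?thesis by (auto elim: countable_subset[rotated])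
qed

text \<open>
  The hypothesis says that \<open>h t / t\<close> has derivative at least \<open>- w / t\<close> wherever it is differentiable,
  so that \<open>h t / t + w * ln t\<close> is nondecreasing.
\<close>
lemma concave_quotient_log_growth:
  fixes h :: "real \<Rightarrow> real"
  assumes "concave_on {0<..} h"
    and w: "\<And>t. 0 < t \<Longrightarrow> h differentiable (at t) \<Longrightarrow> h t / t - deriv h t \<le> w"
    and "0 < s" "s \<le> t"
  shows "h s / s \<le> h t / t + w * ln (t / s)"
proof -
  have cvx: "convex_on {0<..} (\<lambda>t. - h t)" using assms(1) by (simp add: concave_on_def)
  define D where "D = {t \<in> {0<..}. \<not> (\<lambda>t. - h t) differentiable (at t)}"
  have "countable D" unfolding D_def by (rule convex_on_countable_not_differentiable[OF cvx]) simp
  have "continuous_on {0<..} (\<lambda>t. - h t)" by (rule convex_on_continuous[OF _ cvx]) simp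
  then have conth: "continuous_on {0<..} h" using continuous_on_minus by fastforce
  have "h s / s + w * ln s \<le> h t / t + w * ln t"
  proof (rule nondecreasing_except_countable[OF \<open>s \<le> t\<close> _ \<open>countable D\<close>])
    show "continuous_on {s..t} (\<lambda>x. h x / x + w * ln x)"
      using \<open>0 < s\<close> by (intro continuous_intros continuous_on_subset[OF conth]) auto
    fix x assume x: "x \<in> {s..t} - D"
    then have "0 < x" using \<open>0 < s\<close> by auto
    then have "(\<lambda>t. - h t) differentiable (at x)" using x unfolding D_def by auto
    from differentiable_minus[OF this] have hd: "h differentiable (at x)" by simp
    then have "(h has_real_derivative deriv h x) (at x)"
      by (metis DERIV_imp_deriv real_differentiable_def)
    then show "((\<lambda>x. h x / x + w * ln x) has_real_derivative
        (w - (h x / x - deriv h x)) / x) (at x)"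
      using \<open>0 < x\<close> by (auto intro!: derivative_eq_intros simp: field_simps)
    show "0 \<le> (w - (h x / x - deriv h x)) / x"
      using w[OF \<open>0 < x\<close> hd] \<open>0 < x\<close> by simp
  qed
  then show ?thesis using assms(3,4) by (simp add: ln_div algebra_simps)
qed

section \<open>Interpolation norms as integrals of the averaged K-functional\<close>

text \<open>
  In the model couple \<open>(L\<^sup>1, L\<^sup>\<infinity>)\<close> this is the maximal average \<open>f\<^sup>*\<^sup>*\<close> of the decreasing
  rearrangement. The value \<open>0\<close> on the negative half-line lets integrals run over the whole line.
\<close>
definition K_mean ::
    "('a::banach \<Rightarrow> 'v::hausdorff_tvs) \<Rightarrow> ('b::banach \<Rightarrow> 'v) \<Rightarrow> 'v \<Rightarrow> real \<Rightarrow> real" where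
  "K_mean e0 e1 f t = (if 0 < t then K_functional e0 e1 t f / t else 0)"

lemma K_mean_nonneg: "f \<in> couple_sum e0 e1 \<Longrightarrow> 0 \<le> K_mean e0 e1 f t"
  by (simp add: K_mean_def K_functional_nonneg)

lemma K_mean_antimono:
  "f \<in> couple_sum e0 e1 \<Longrightarrow> 0 < s \<Longrightarrow> s \<le> t \<Longrightarrow> K_mean e0 e1 f t \<le> K_mean e0 e1 f s"
  by (simp add: K_mean_def K_functional_div_antimono)

lemma K_mean_continuous:
  assumes "f \<in> couple_sum e0 e1"
  shows "continuous_on {0<..} (K_mean e0 e1 f)"
proof -
  have "continuous_on {0<..} (\<lambda>t. - K_functional e0 e1 t f)"
    using K_functional_concave[OF assms] by (intro convex_on_continuous) (simp_all add: concave_on_def)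
  from continuous_on_minus[OF this]
  have "continuous_on {0<..} (\<lambda>t. K_functional e0 e1 t f / t)"
    by (intro continuous_on_divide continuous_on_id) auto
  then show ?thesis by (rule continuous_on_eq) (simp add: K_mean_def)
qed

lemma borel_measurable_half_line:
  fixes \<phi> :: "real \<Rightarrow> real"
  assumes "continuous_on {0<..} \<phi>" "\<And>t. t \<le> 0 \<Longrightarrow> \<phi> t = 0"
  shows "\<phi> \<in> borel_measurable borel"
proof -
  have "(\<lambda>t. indicator {0<..} t *\<^sub>R \<phi> t) \<in> borel_measurable borel"
    by (rule borel_measurable_continuous_on_indicator[OF _ assms(1)]) simp
  moreover have "(\<lambda>t. indicator {0<..} t *\<^sub>R \<phi> t) = \<phi>"
    using assms(2) by (auto simp: fun_eq_iff indicator_def)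
  ultimately show ?thesis by simp
qed

lemma K_mean_measurable [measurable]:
  "f \<in> couple_sum e0 e1 \<Longrightarrow> K_mean e0 e1 f \<in> borel_measurable borel"
  by (rule borel_measurable_half_line[OF K_mean_continuous]) (simp_all add: K_mean_def)

text \<open>
  At \<open>\<eta> = 1 - 1 / q\<close> the weights cancel, and the interpolation norm is the plain \<open>L\<^sup>q\<close> norm of \<open>K_mean\<close>.
\<close>
lemma interp_norm_eq:
  assumes "f \<in> couple_sum e0 e1" "0 < q"
  shows "interp_norm e0 e1 (1 - 1 / q) q f =
    ennreal_powr (\<integral>\<^sup>+t. ennreal (K_mean e0 e1 f t powr q) \<partial>lborel) (1 / q)"
proof -
  have "ennreal ((t powr - (1 - 1 / q) * K_functional e0 e1 t f) powr q / t) * indicator {0<..} t =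
      ennreal (K_mean e0 e1 f t powr q)" for t
  proof (cases "0 < t")
    case True
    have K: "0 \<le> K_functional e0 e1 t f" using K_functional_nonneg[OF assms(1)] True by simp
    have "(t powr - (1 - 1 / q)) powr q / t = t powr (1 - q) / t powr 1"
      using assms(2) True by (simp add: powr_powr algebra_simps)
    also have "\<dots> = t powr (- q)"
      by (subst powr_diff[symmetric]) simp
    finally have t: "(t powr - (1 - 1 / q)) powr q / t = t powr (- q)" .
    have "(t powr - (1 - 1 / q) * K_functional e0 e1 t f) powr q / t =
        ((t powr - (1 - 1 / q)) powr q / t) * K_functional e0 e1 t f powr q"
      using K by (simp add: powr_mult)
    also have "\<dots> = (K_functional e0 e1 t f / t) powr q"
      unfolding t using K True by (simp add: powr_divide powr_minus_divide)
    finally show ?thesis using True by (simp add: K_mean_def)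
  next
    case False
    then show ?thesis using assms(2) by (simp add: K_mean_def)
  qed
  then show ?thesis using assms(1) by (simp add: interp_norm_def)
qed

lemma ennreal_powr_ennreal: "0 \<le> i \<Longrightarrow> ennreal_powr (ennreal i) a = ennreal (i powr a)"
  by (simp add: ennreal_powr_def)

lemma interp_space_iff:
  assumes "0 < q"
  shows "f \<in> interp_space e0 e1 (1 - 1 / q) q \<longleftrightarrow> f \<in> couple_sum e0 e1 \<and>
    (\<integral>\<^sup>+t. ennreal (K_mean e0 e1 f t powr q) \<partial>lborel) < \<infinity>"
proof -
  have "ennreal_powr x a < \<infinity> \<longleftrightarrow> x < \<infinity>" for x a
    by (auto simp: ennreal_powr_def less_top)
  then show ?thesis using assms by (auto simp: interp_space_def interp_norm_eq)
qed

lemma interp_spaceE: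
  assumes "f \<in> interp_space e0 e1 (1 - 1 / q) q" "0 < q"
  obtains i where "f \<in> couple_sum e0 e1" "0 \<le> i"
    "(\<integral>\<^sup>+t. ennreal (K_mean e0 e1 f t powr q) \<partial>lborel) = ennreal i"
    "interp_norm e0 e1 (1 - 1 / q) q f = ennreal (i powr (1 / q))"
proof -
  let ?I = "\<integral>\<^sup>+t. ennreal (K_mean e0 e1 f t powr q) \<partial>lborel"
  have f: "f \<in> couple_sum e0 e1" "?I < \<infinity>" using assms interp_space_iff by blast+
  then have I: "?I = ennreal (enn2real ?I)" by simp
  have "interp_norm e0 e1 (1 - 1 / q) q f = ennreal (enn2real ?I powr (1 / q))"
    unfolding interp_norm_eq[OF f(1) assms(2)]
    by (subst I) (simp only: ennreal_powr_ennreal enn2real_nonneg)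
  then show ?thesis using that f(1) I enn2real_nonneg by blast
qed

section \<open>The weak-type functional and the doubled exponent\<close>

text \<open>
  Chebyshev's inequality for a nonincreasing function.
\<close>
lemma antimono_integral_ge:
  fixes \<phi> :: "real \<Rightarrow> real"
  assumes "\<And>s. 0 < s \<Longrightarrow> s \<le> t \<Longrightarrow> \<phi> t \<le> \<phi> s" "0 \<le> \<phi> t" "0 < t" "0 \<le> q"
  shows "ennreal (t * \<phi> t powr q) \<le> (\<integral>\<^sup>+s. ennreal (\<phi> s powr q) \<partial>lborel)"
proof -
  have "ennreal (t * \<phi> t powr q) = ennreal (\<phi> t powr q) * emeasure lborel {0<..t}"
    using assms(3) by (simp add: ennreal_mult[symmetric] mult.commute)
  also have "\<dots> = (\<integral>\<^sup>+s. ennreal (\<phi> t powr q) * indicator {0<..t} s \<partial>lborel)"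
    by (simp add: nn_integral_cmult_indicator)
  also have "\<dots> \<le> (\<integral>\<^sup>+s. ennreal (\<phi> s powr q) \<partial>lborel)"
    using assms by (intro nn_integral_mono) (auto simp: indicator_def intro!: ennreal_leI powr_mono2)
  finally show ?thesis .
qed

lemma one_plus_ln_le_powr:
  fixes x a :: real
  assumes "0 < a" "a \<le> 1" "1 \<le> x"
  shows "1 + ln x \<le> x powr a / a"
proof -
  have "a * ln x = ln (x powr a)" using assms by (simp add: ln_powr)
  also have "\<dots> \<le> x powr a - 1" using assms by (intro ln_le_minus_one) simp
  finally show ?thesis using assms by (simp add: field_simps)
qed

text \<open>
  Where \<open>\<phi> \<le> w\<close>, the excess factor \<open>\<phi> powr p\<close> is at most \<open>w powr p\<close>. If \<open>\<phi>\<close> exceeds \<open>w\<close> somewhere,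
  there is \<open>s\<close> with \<open>\<phi> s = w\<close>, and \<open>\<phi> > w\<close> only on a part of \<open>(0, s)\<close>; there \<open>\<phi>\<close> is at most \<open>w * (1 + ln (s / t))\<close>, whose \<open>2 * p\<close>-th power
  integrates to a multiple of \<open>w powr (2 * p) * s\<close>, and \<open>s * w powr p\<close> is at most the integral of
  \<open>\<phi> powr p\<close> by Chebyshev.
\<close>
lemma log_growth_integral_le:
  fixes \<phi> :: "real \<Rightarrow> real"
  assumes cont: "continuous_on {0<..} \<phi>" and zero: "\<And>t. t \<le> 0 \<Longrightarrow> \<phi> t = 0"
    and nonneg: "\<And>t. 0 \<le> \<phi> t"
    and antimono: "\<And>s t. 0 < s \<Longrightarrow> s \<le> t \<Longrightarrow> \<phi> t \<le> \<phi> s"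
    and log: "\<And>s t. 0 < s \<Longrightarrow> s \<le> t \<Longrightarrow> \<phi> s \<le> \<phi> t + w * ln (t / s)"
    and w: "0 < w" and p: "1 \<le> p"
    and fin: "(\<integral>\<^sup>+t. ennreal (\<phi> t powr p) \<partial>lborel) < \<infinity>"
  shows "(\<integral>\<^sup>+t. ennreal (\<phi> t powr (2 * p)) \<partial>lborel)
    \<le> ennreal ((1 + 2 * (4 * p) powr (2 * p)) * w powr p) * (\<integral>\<^sup>+t. ennreal (\<phi> t powr p) \<partial>lborel)"
    (is "?I2 \<le> _ * ?I")
proof -
  let ?c = "(4 * p) powr (2 * p)"
  have [measurable]: "\<phi> \<in> borel_measurable borel"
    by (rule borel_measurable_half_line[OF cont zero])
  have small: "\<phi> t powr (2 * p) \<le> w powr p * \<phi> t powr p" if "\<phi> t \<le> w" for t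
  proof -
    have "\<phi> t powr (2 * p) = \<phi> t powr p * \<phi> t powr p" by (simp add: powr_add[symmetric])
    also have "\<dots> \<le> w powr p * \<phi> t powr p"
      using that nonneg p by (intro mult_right_mono powr_mono2) auto
    finally show ?thesis .
  qed
  have I: "?I = ennreal (enn2real ?I)" using fin by simp
  show ?thesis
  proof (cases "\<forall>t. \<phi> t \<le> w")
    case True
    have "?I2 \<le> (\<integral>\<^sup>+t. ennreal (w powr p) * ennreal (\<phi> t powr p) \<partial>lborel)"
      using small True by (intro nn_integral_mono) (simp add: ennreal_mult[symmetric])
    also have "\<dots> = ennreal (w powr p) * ?I" by (rule nn_integral_cmult) simp
    also have "\<dots> \<le> ennreal ((1 + 2 * ?c) * w powr p) * ?I"
      by (intro mult_right_mono ennreal_leI) (auto simp: algebra_simps)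
    finally show ?thesis .
  next
    case False
    then obtain t0 where t0: "w < \<phi> t0" by (auto simp: not_le)
    then have "0 < t0" using zero[of t0] w by (cases "t0 \<le> 0") auto
    \<comment> \<open>Otherwise \<open>\<phi>\<close> would exceed \<open>w\<close> on the whole half-line and not be \<open>p\<close>-integrable.\<close>
    have "\<exists>t1. t0 \<le> t1 \<and> \<phi> t1 \<le> w"
    proof (rule ccontr)
      assume "\<nexists>t1. t0 \<le> t1 \<and> \<phi> t1 \<le> w"
      then have big: "w < \<phi> t" if "t0 \<le> t" for t using that by (meson not_le)
      define t where "t = t0 + (enn2real ?I + 1) / w powr p"
      have "0 \<le> (enn2real ?I + 1) / w powr p" by simp
      then have "t0 \<le> t" "0 < t" using \<open>0 < t0\<close> unfolding t_def by linarith+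
      have "ennreal (t * \<phi> t powr p) \<le> ennreal (enn2real ?I)"
        unfolding I[symmetric] using antimono nonneg \<open>0 < t\<close> p by (intro antimono_integral_ge) auto
      then have "t * \<phi> t powr p \<le> enn2real ?I" by simp
      moreover have "t * w powr p \<le> t * \<phi> t powr p"
        using big[OF \<open>t0 \<le> t\<close>] \<open>0 < t\<close> w p by (intro mult_left_mono powr_mono2) auto
      moreover have "t * w powr p = t0 * w powr p + enn2real ?I + 1"
        using w by (simp add: t_def field_simps)
      moreover have "0 \<le> t0 * w powr p" using \<open>0 < t0\<close> by simp
      ultimately show False by linarith
    qed
    then obtain t1 where t1: "t0 \<le> t1" "\<phi> t1 \<le> w" by blast
    have "\<exists>s\<ge>t0. s \<le> t1 \<and> \<phi> s = w"
      using t0 t1 \<open>0 < t0\<close> by (intro IVT2' continuous_on_subset[OF cont]) auto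
    then obtain s where "t0 \<le> s" "\<phi> s = w" by blast
    then have "0 < s" using \<open>0 < t0\<close> by linarith
    have "ennreal (s * w powr p) \<le> ?I"
      using antimono_integral_ge[of s \<phi> p] antimono nonneg \<open>0 < s\<close> p \<open>\<phi> s = w\<close> by auto
    then have sw: "s * w powr p \<le> enn2real ?I"
      by (subst (asm) I) simp
    \<comment> \<open>With the exponent \<open>1 / (4 * p)\<close> the logarithm, raised to the power \<open>2 * p\<close>, is dominated by
      the integrable \<open>(s / t) powr (1/2)\<close>.\<close>
    have pointwise: "\<phi> t powr (2 * p) \<le> w powr p * \<phi> t powr p +
        ?c * w powr (2 * p) * s powr (1/2) * (indicator {0..s} t * t powr (- (1/2)))" for t
    proof (cases "0 < t \<and> t < s")
      case True
      then have "\<phi> t \<le> w + w * ln (s / t)" using log[of t s] \<open>\<phi> s = w\<close> by simp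
      also have "\<dots> = w * (1 + ln (s / t))" by (simp add: algebra_simps)
      also have "\<dots> \<le> w * ((s / t) powr (1 / (4 * p)) / (1 / (4 * p)))"
        using True w p by (intro mult_left_mono one_plus_ln_le_powr) auto
      also have "\<dots> = (4 * p) * w * (s / t) powr (1 / (4 * p))" by simp
      finally have "\<phi> t powr (2 * p) \<le> ((4 * p) * w * (s / t) powr (1 / (4 * p))) powr (2 * p)"
        using nonneg p by (intro powr_mono2) auto
      also have "\<dots> = ?c * w powr (2 * p) * (s / t) powr (1 / 2)"
        using w p True by (simp add: powr_mult powr_powr)
      also have "\<dots> = ?c * w powr (2 * p) * s powr (1/2) * (indicator {0..s} t * t powr (- (1/2)))"
        using True by (simp add: powr_divide powr_minus_divide)
      finally have "\<phi> t powr (2 * p) \<le>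
          ?c * w powr (2 * p) * s powr (1/2) * (indicator {0..s} t * t powr (- (1/2)))" .
      moreover have "0 \<le> w powr p * \<phi> t powr p" by simp
      ultimately show ?thesis by linarith
    next
      case False
      then have "\<phi> t \<le> w"
        using zero[of t] antimono[of s t] \<open>\<phi> s = w\<close> \<open>0 < s\<close> w by (cases "t \<le> 0") auto
      moreover have "0 \<le> ?c * w powr (2 * p) * s powr (1/2) * (indicator {0..s} t * t powr (- (1/2)))"
        by simp
      ultimately show ?thesis using small[of t] by linarith
    qed
    have "((\<lambda>t. t powr (- (1/2))) has_integral (s powr (- (1/2) + 1) / (- (1/2) + 1))) {0..s}"
      using \<open>0 < s\<close> by (intro has_integral_powr_from_0) auto
    then have J: "(\<integral>\<^sup>+t. ennreal (indicator {0..s} t * t powr (- (1/2))) \<partial>lborel) = ennreal (2 * s powr (1/2))"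
      by (subst nn_integral_has_integral_lebesgue) (auto simp: mult.commute)
    have "?I2 \<le> (\<integral>\<^sup>+t. ennreal (w powr p) * ennreal (\<phi> t powr p) +
        ennreal (?c * w powr (2 * p) * s powr (1/2)) * ennreal (indicator {0..s} t * t powr (- (1/2))) \<partial>lborel)"
      using pointwise by (intro nn_integral_mono)
        (simp add: ennreal_mult[symmetric] ennreal_plus[symmetric] del: ennreal_plus)
    also have "\<dots> = ennreal (w powr p) * ?I + ennreal (?c * w powr (2 * p) * s powr (1/2)) * ennreal (2 * s powr (1/2))"
      by (simp add: nn_integral_add nn_integral_cmult J)
    also have "\<dots> = ennreal (w powr p * enn2real ?I + ?c * w powr (2 * p) * s powr (1/2) * (2 * s powr (1/2)))"
      by (subst I) (simp add: ennreal_mult[symmetric] ennreal_plus[symmetric] del: ennreal_plus)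
    also have "?c * w powr (2 * p) * s powr (1/2) * (2 * s powr (1/2)) = 2 * ?c * w powr p * (s * w powr p)"
    proof -
      have "s powr (1/2) * s powr (1/2) = s" using \<open>0 < s\<close> by (simp add: powr_add[symmetric])
      moreover have "w powr (2 * p) = w powr p * w powr p" by (simp add: powr_add[symmetric])
      ultimately show ?thesis by (simp add: algebra_simps)
    qed
    also have "ennreal (w powr p * enn2real ?I + 2 * ?c * w powr p * (s * w powr p)) \<le>
        ennreal (w powr p * enn2real ?I + 2 * ?c * w powr p * enn2real ?I)"
      using sw by (intro ennreal_leI add_left_mono mult_left_mono) auto
    also have "\<dots> = ennreal ((1 + 2 * ?c) * w powr p * enn2real ?I)"
      by (simp add: algebra_simps)
    also have "\<dots> = ennreal ((1 + 2 * ?c) * w powr p) * ?I"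
      by (subst (2) I) (simp add: ennreal_mult[symmetric])
    finally show ?thesis .
  qed
qed

lemma K_mean_log_growth:
  assumes f: "f \<in> couple_sum e0 e1" and w: "weak_limit_norm e0 e1 f \<le> ennreal w" "0 \<le> w"
    and "0 < s" "s \<le> t"
  shows "K_mean e0 e1 f s \<le> K_mean e0 e1 f t + w * ln (t / s)"
proof -
  have "K_functional e0 e1 s f / s \<le> K_functional e0 e1 t f / t + w * ln (t / s)"
  proof (rule concave_quotient_log_growth[OF K_functional_concave[OF f] _ assms(4,5)])
    fix x :: real
    assume "0 < x" "(\<lambda>s. K_functional e0 e1 s f) differentiable (at x)"
    then have "ennreal (K_functional e0 e1 x f / x - deriv (\<lambda>s. K_functional e0 e1 s f) x)
        \<le> weak_limit_norm e0 e1 f"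
      unfolding weak_limit_norm_def if_P[OF f] by (intro SUP_upper) simp
    with w(1) have "ennreal (K_functional e0 e1 x f / x - deriv (\<lambda>s. K_functional e0 e1 s f) x)
        \<le> ennreal w" by (rule order_trans[rotated])
    then show "K_functional e0 e1 x f / x - deriv (\<lambda>s. K_functional e0 e1 s f) x \<le> w"
      unfolding ennreal_le_iff[OF w(2)] .
  qed
  then show ?thesis using assms(4,5) by (simp add: K_mean_def)
qed

lemma K_mean_integral_weak_le:
  assumes f: "f \<in> couple_sum e0 e1" and p: "1 \<le> p"
    and i: "(\<integral>\<^sup>+t. ennreal (K_mean e0 e1 f t powr p) \<partial>lborel) = ennreal i" "0 \<le> i"
    and w: "weak_limit_norm e0 e1 f \<le> ennreal w" "0 \<le> w"
  shows "(\<integral>\<^sup>+t. ennreal (K_mean e0 e1 f t powr (2 * p)) \<partial>lborel)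
    \<le> ennreal ((1 + 2 * (4 * p) powr (2 * p)) * w powr p * i)"
proof -
  let ?c = "1 + 2 * (4 * p) powr (2 * p)"
  let ?I = "\<integral>\<^sup>+t. ennreal (K_mean e0 e1 f t powr (2 * p)) \<partial>lborel"
  have le: "?I \<le> ennreal (?c * v powr p * i)" if "w < v" for v
  proof -
    have v: "0 < v" "weak_limit_norm e0 e1 f \<le> ennreal v"
      using w that by (auto intro: order_trans[OF w(1)] ennreal_leI)
    have "?I \<le> ennreal (?c * v powr p) * (\<integral>\<^sup>+t. ennreal (K_mean e0 e1 f t powr p) \<partial>lborel)"
    proof (rule log_growth_integral_le[OF K_mean_continuous[OF f] _ K_mean_nonneg[OF f]
          K_mean_antimono[OF f] K_mean_log_growth[OF f v(2)] v(1) p])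
      show "K_mean e0 e1 f t = 0" if "t \<le> 0" for t using that by (simp add: K_mean_def)
      show "(\<integral>\<^sup>+t. ennreal (K_mean e0 e1 f t powr p) \<partial>lborel) < \<infinity>" unfolding i(1) by simp
    qed (use v(1) in auto)
    also have "\<dots> = ennreal (?c * v powr p * i)"
      unfolding i(1) by (rule ennreal_mult[symmetric]) (use i(2) in auto)
    finally show ?thesis .
  qed
  \<comment> \<open>Letting \<open>v\<close> decrease to \<open>w\<close> also covers \<open>w = 0\<close>.\<close>
  have "((\<lambda>v. v powr p) \<longlongrightarrow> w powr p) (at_right w)"
  proof (rule tendsto_powr'[OF tendsto_ident_at tendsto_const])
    have "\<forall>\<^sub>F v in at_right w. 0 \<le> v"
      using eventually_at_right_less[of w] by eventually_elim (use w(2) in simp)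
    then show "w \<noteq> 0 \<or> 0 < p \<and> (\<forall>\<^sub>F v in at_right w. 0 \<le> v)" using p by simp
  qed
  then have "((\<lambda>v. ennreal (?c * v powr p * i)) \<longlongrightarrow> ennreal (?c * w powr p * i)) (at_right w)"
    by (intro tendsto_ennrealI tendsto_mult tendsto_const)
  then show ?thesis
  proof (rule tendsto_lowerbound)
    show "\<forall>\<^sub>F v in at_right w. ?I \<le> ennreal (?c * v powr p * i)"
      using eventually_at_right_less[of w] by eventually_elim (rule le)
  qed simp
qed

text \<open>
  The previous integral bound has right-hand side \<open>w powr p * n powr p\<close> up to a constant; its root of order
  \<open>2 * p\<close> is the geometric mean \<open>sqrt (n * w)\<close>.
\<close>
lemma interp_norm_weak_le:
  assumes f: "f \<in> interp_space e0 e1 (1 - 1 / p) p" and p: "1 \<le> p"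
    and n: "interp_norm e0 e1 (1 - 1 / p) p f = ennreal n" "0 \<le> n"
    and w: "weak_limit_norm e0 e1 f \<le> ennreal w" "0 \<le> w"
  shows "f \<in> interp_space e0 e1 (1 - 1 / (2 * p)) (2 * p)"
    and "interp_norm e0 e1 (1 - 1 / (2 * p)) (2 * p) f
      \<le> ennreal ((1 + 2 * (4 * p) powr (2 * p)) powr (1 / (2 * p)) * sqrt (n * w))"
proof -
  let ?c = "1 + 2 * (4 * p) powr (2 * p)"
  let ?I = "\<integral>\<^sup>+t. ennreal (K_mean e0 e1 f t powr (2 * p)) \<partial>lborel"
  have "0 < p" "0 < 2 * p" using p by auto
  obtain i where i: "f \<in> couple_sum e0 e1" "0 \<le> i"
      "(\<integral>\<^sup>+t. ennreal (K_mean e0 e1 f t powr p) \<partial>lborel) = ennreal i"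
      "interp_norm e0 e1 (1 - 1 / p) p f = ennreal (i powr (1 / p))"
    using interp_spaceE[OF f \<open>0 < p\<close>] by blast
  have "n = i powr (1 / p)" using i(4) n by simp
  then have ni: "i = n powr p" using i(2) p by (simp add: powr_powr)
  have le: "?I \<le> ennreal (?c * w powr p * i)"
    by (rule K_mean_integral_weak_le[OF i(1) p i(3,2) w])
  then have fin: "?I < \<infinity>" by (rule order_le_less_trans) simp
  then show X: "f \<in> interp_space e0 e1 (1 - 1 / (2 * p)) (2 * p)"
    unfolding interp_space_iff[OF \<open>0 < 2 * p\<close>] using i(1) by blast
  obtain j where j: "0 \<le> j" "?I = ennreal j"
      "interp_norm e0 e1 (1 - 1 / (2 * p)) (2 * p) f = ennreal (j powr (1 / (2 * p)))"
    using interp_spaceE[OF X \<open>0 < 2 * p\<close>] by blast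
  have "0 \<le> ?c * w powr p * i" using i(2) by simp
  then have "j \<le> ?c * w powr p * i" using le unfolding j(2) by (simp only: ennreal_le_iff)
  then have "j powr (1 / (2 * p)) \<le> (?c * w powr p * i) powr (1 / (2 * p))"
    using j(1) p by (intro powr_mono2) auto
  also have "\<dots> = ?c powr (1 / (2 * p)) * (w powr (1 / 2) * n powr (1 / 2))"
    unfolding ni using p by (simp add: powr_mult powr_powr)
  also have "w powr (1 / 2) * n powr (1 / 2) = sqrt (n * w)"
    using w(2) n(2) by (simp add: powr_half_sqrt real_sqrt_mult)
  finally show "interp_norm e0 e1 (1 - 1 / (2 * p)) (2 * p) f \<le> ennreal (?c powr (1 / (2 * p)) * sqrt (n * w))"
    unfolding j(3) by (rule ennreal_leI)
qed

section \<open>Integral inequalities for dyadic averages\<close>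

text \<open>
  A discrete Hardy inequality: the sum over dyadic dilations stands for the average of \<open>\<psi>\<close> over
  \<open>(0, t)\<close>.
\<close>
lemma dyadic_average_integral_le:
  fixes p C :: real
  assumes p: "1 < p" and C: "0 < C"
  shows "\<exists>D\<ge>0. \<forall>F \<psi> :: real \<Rightarrow> real. \<psi> \<in> borel_measurable borel \<longrightarrow> (\<forall>t. 0 \<le> \<psi> t) \<longrightarrow>
    (\<forall>t. 0 \<le> F t \<and> F t \<le> C * (\<Sum>k. \<psi> (t / 2 ^ k) / 2 ^ k)) \<longrightarrow>
    (\<integral>\<^sup>+t. ennreal (F t powr p) \<partial>lborel) \<le> ennreal D * (\<integral>\<^sup>+t. ennreal (\<psi> t powr p) \<partial>lborel)"
proof -
  have finite_real: "\<exists>S\<ge>0. x = ennreal S" if "x \<noteq> \<infinity>" for x :: ennreal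
    using that by (cases x) auto
  have le_suminf: "u k \<le> suminf u" for u :: "nat \<Rightarrow> ennreal" and k
    using sum_le_suminf[of u "{k}"] by simp
  \<comment> \<open>The weight \<open>1 / 2 ^ k\<close> is split as \<open>a ^ k * c ^ k\<close>: the factor \<open>a ^ k\<close> makes the sum over \<open>k\<close>
    converge, and \<open>c ^ k\<close> has to beat the factor \<open>2 ^ k\<close> from rescaling the integral, that is
    \<open>2 * c powr p < 1\<close>. Any \<open>\<delta>\<close> strictly between \<open>0\<close> and \<open>1 - 1 / p\<close> achieves both; this is the
    midpoint.\<close>
  define \<delta> where "\<delta> = (p - 1) / (2 * p)"
  define a where "a = 2 powr (- \<delta>)"
  define c where "c = 2 powr (\<delta> - 1)"
  define d where "d = 2 powr (- ((p - 1) / 2))"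
  have "0 < \<delta>" using p by (simp add: \<delta>_def)
  have a: "0 < a" "a < 1" using \<open>0 < \<delta>\<close> powr_less_mono[of "-\<delta>" 0 2] by (simp_all add: a_def)
  have d: "0 < d" "d < 1" using p powr_less_mono[of "-((p-1)/2)" 0 2] by (simp_all add: d_def)
  have "0 < c" by (simp add: c_def)
  have "a * c = 2 powr (- 1)" by (simp add: a_def c_def powr_add[symmetric])
  then have ac: "a * c = 1 / 2" by (simp add: powr_minus_divide)
  have cd: "c powr p * 2 = d"
  proof -
    have "c powr p * 2 = 2 powr ((\<delta> - 1) * p + 1)" by (simp add: c_def powr_powr powr_add)
    also have "(\<delta> - 1) * p + 1 = - ((p - 1) / 2)" using p by (simp add: \<delta>_def field_simps)
    finally show ?thesis by (simp add: d_def)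
  qed
  define A where "A = 1 / (1 - a)"
  have A: "(\<lambda>k. a ^ k) sums A" using a geometric_sums[of a] by (simp add: A_def)
  have "0 < A" using a by (simp add: A_def)
  define D where "D = (C * A) powr p * (1 / (1 - d))"
  have main: "(\<integral>\<^sup>+t. ennreal (F t powr p) \<partial>lborel) \<le> ennreal D * (\<integral>\<^sup>+t. ennreal (\<psi> t powr p) \<partial>lborel)"
    if [measurable]: "\<psi> \<in> borel_measurable borel" and \<psi>: "\<And>t. 0 \<le> \<psi> t"
      and F: "\<And>t. 0 \<le> F t" "\<And>t. F t \<le> C * (\<Sum>k. \<psi> (t / 2 ^ k) / 2 ^ k)" for F \<psi> :: "real \<Rightarrow> real"
  proof -
    let ?J = "\<integral>\<^sup>+t. ennreal (\<psi> t powr p) \<partial>lborel"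
    let ?term = "\<lambda>k t. ennreal ((c ^ k * \<psi> (t / 2 ^ k)) powr p)"
    have pointwise: "ennreal (F t powr p) \<le> ennreal ((C * A) powr p) * (\<Sum>k. ?term k t)" for t
    proof (cases "(\<Sum>k. ?term k t) = \<infinity>")
      case True
      then show ?thesis using C \<open>0 < A\<close> by (simp add: ennreal_mult_top)
    next
      case False
      then obtain S where S: "(\<Sum>k. ?term k t) = ennreal S" "0 \<le> S"
        using finite_real by blast
      \<comment> \<open>Bounding every term by the whole sum replaces the triangle inequality in \<open>L\<^sup>p\<close>.\<close>
      have term_le: "c ^ k * \<psi> (t / 2 ^ k) \<le> S powr (1 / p)" for k
      proof -
        have "?term k t \<le> (\<Sum>k. ?term k t)"
          by (rule le_suminf)
        then have "(c ^ k * \<psi> (t / 2 ^ k)) powr p \<le> S"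
          unfolding S(1) ennreal_le_iff[OF S(2)] .
        then have "((c ^ k * \<psi> (t / 2 ^ k)) powr p) powr (1 / p) \<le> S powr (1 / p)"
          using p by (intro powr_mono2) auto
        then show ?thesis using p \<psi> \<open>0 < c\<close> by (simp add: powr_powr)
      qed
      have le: "\<psi> (t / 2 ^ k) / 2 ^ k \<le> a ^ k * S powr (1 / p)" for k
      proof -
        have "\<psi> (t / 2 ^ k) / 2 ^ k = (a * c) ^ k * \<psi> (t / 2 ^ k)"
          unfolding ac by (simp add: power_one_over)
        also have "\<dots> = a ^ k * (c ^ k * \<psi> (t / 2 ^ k))"
          by (simp add: power_mult_distrib)
        also have "\<dots> \<le> a ^ k * S powr (1 / p)"
          using a by (intro mult_left_mono term_le) simp
        finally show ?thesis .
      qed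
      have sums: "(\<lambda>k. a ^ k * S powr (1 / p)) sums (A * S powr (1 / p))"
        by (rule sums_mult2[OF A])
      have summable: "summable (\<lambda>k. \<psi> (t / 2 ^ k) / 2 ^ k)"
        by (rule summable_comparison_test'[OF sums_summable[OF sums], of 0]) (use le \<psi> in auto)
      have "(\<Sum>k. \<psi> (t / 2 ^ k) / 2 ^ k) \<le> A * S powr (1 / p)"
        using sums_le[OF le summable_sums[OF summable] sums] .
      then have "F t \<le> C * (A * S powr (1 / p))"
        using F(2)[of t] C by (meson mult_left_mono order_trans less_imp_le)
      then have "F t powr p \<le> (C * (A * S powr (1 / p))) powr p"
        using F(1) p by (intro powr_mono2) auto
      also have "\<dots> = (C * A) powr p * S"
        using C \<open>0 < A\<close> S p by (simp add: powr_mult powr_powr)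
      finally show ?thesis unfolding S(1) using S(2) by (simp add: ennreal_mult[symmetric])
    qed
    have scaled: "(\<integral>\<^sup>+t. ?term k t \<partial>lborel) = ennreal (d ^ k) * ?J" for k
    proof -
      have "(\<integral>\<^sup>+t. ?term k t \<partial>lborel) = ennreal \<bar>2 ^ k\<bar> * (\<integral>\<^sup>+t. ?term k (0 + 2 ^ k * t) \<partial>lborel)"
        by (rule nn_integral_real_affine) auto
      also have "(\<integral>\<^sup>+t. ?term k (0 + 2 ^ k * t) \<partial>lborel) =
          (\<integral>\<^sup>+t. ennreal ((c powr p) ^ k) * ennreal (\<psi> t powr p) \<partial>lborel)"
      proof (rule nn_integral_cong)
        fix t
        have "(c ^ k) powr p = (c powr p) ^ k"
          using \<open>0 < c\<close> by (simp add: powr_realpow[symmetric] powr_powr mult.commute)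
        then show "?term k (0 + 2 ^ k * t) = ennreal ((c powr p) ^ k) * ennreal (\<psi> t powr p)"
          using \<open>0 < c\<close> \<psi> by (simp add: powr_mult ennreal_mult[symmetric])
      qed
      also have "\<dots> = ennreal ((c powr p) ^ k) * ?J"
        by (rule nn_integral_cmult) simp
      also have "ennreal \<bar>2 ^ k\<bar> * (ennreal ((c powr p) ^ k) * ?J) = ennreal (d ^ k) * ?J"
        unfolding cd[symmetric]
        by (simp add: mult.assoc[symmetric] ennreal_mult[symmetric] power_mult_distrib mult.commute)
      finally show ?thesis .
    qed
    have "(\<integral>\<^sup>+t. ennreal (F t powr p) \<partial>lborel)
        \<le> (\<integral>\<^sup>+t. ennreal ((C * A) powr p) * (\<Sum>k. ?term k t) \<partial>lborel)"
      by (intro nn_integral_mono pointwise)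
    also have "\<dots> = ennreal ((C * A) powr p) * (\<Sum>k. \<integral>\<^sup>+t. ?term k t \<partial>lborel)"
      by (simp add: nn_integral_cmult nn_integral_suminf)
    also have "(\<Sum>k. \<integral>\<^sup>+t. ?term k t \<partial>lborel) = (\<Sum>k. ennreal (d ^ k)) * ?J"
      unfolding scaled by (rule ennreal_suminf_multc)
    also have "(\<Sum>k. ennreal (d ^ k)) = ennreal (1 / (1 - d))"
      using d by (subst suminf_ennreal2) (auto simp: suminf_geometric summable_geometric)
    also have "ennreal ((C * A) powr p) * (ennreal (1 / (1 - d)) * ?J) = ennreal D * ?J"
      unfolding D_def using d by (subst ennreal_mult) (simp_all add: mult.assoc)
    finally show ?thesis .
  qed
  have "0 \<le> D" using d by (simp add: D_def)
  with main show ?thesis by blast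
qed

text \<open>
  Cauchy--Schwarz for the \<open>p\<close>-th powers.
\<close>
lemma integral_product_le:
  fixes \<phi> \<psi> :: "real \<Rightarrow> real"
  assumes [measurable]: "\<phi> \<in> borel_measurable borel" "\<psi> \<in> borel_measurable borel"
    and "\<And>t. 0 \<le> \<phi> t" "\<And>t. 0 \<le> \<psi> t"
  shows "(\<integral>\<^sup>+t. ennreal ((\<phi> t * \<psi> t) powr p) \<partial>lborel)\<^sup>2 \<le>
    (\<integral>\<^sup>+t. ennreal (\<phi> t powr (2 * p)) \<partial>lborel) * (\<integral>\<^sup>+t. ennreal (\<psi> t powr (2 * p)) \<partial>lborel)"
proof -
  have sq: "(ennreal (x powr p))\<^sup>2 = ennreal (x powr (2 * p))" for x :: real
    by (simp add: power2_eq_square ennreal_mult[symmetric] powr_add[symmetric])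
  have "(\<integral>\<^sup>+t. ennreal (\<phi> t powr p) * ennreal (\<psi> t powr p) \<partial>lborel)\<^sup>2 \<le>
      (\<integral>\<^sup>+t. (ennreal (\<phi> t powr p))\<^sup>2 \<partial>lborel) * (\<integral>\<^sup>+t. (ennreal (\<psi> t powr p))\<^sup>2 \<partial>lborel)"
    by (rule Cauchy_Schwarz_nn_integral) auto
  then show ?thesis
    unfolding sq using assms(3,4) by (simp add: powr_mult ennreal_mult)
qed

lemma K_mean_decay:
  assumes "f \<in> couple_sum e0 e1" "0 < t" "0 < q"
    and fin: "(\<integral>\<^sup>+t. ennreal (K_mean e0 e1 f t powr q) \<partial>lborel) = ennreal i" "0 \<le> i"
  shows "K_mean e0 e1 f t \<le> (i / t) powr (1 / q)"
proof -
  have "ennreal (t * K_mean e0 e1 f t powr q) \<le> ennreal i"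
    unfolding fin(1)[symmetric] using assms
    by (intro antimono_integral_ge) (auto intro: K_mean_antimono K_mean_nonneg)
  then have "K_mean e0 e1 f t powr q \<le> i / t" using assms by (simp add: field_simps)
  then have "(K_mean e0 e1 f t powr q) powr (1 / q) \<le> (i / t) powr (1 / q)"
    using assms(3) by (intro powr_mono2) auto
  then show ?thesis using assms(3) K_mean_nonneg[OF assms(1)] by (simp add: powr_powr)
qed

text \<open>
  This square summability is what makes a vector of the interpolation space admit an adapted
  decomposition, hence a factor in the product constructed below.
\<close>
lemma K_functional_dyadic_summable:
  assumes "f \<in> couple_sum e0 e1" "0 < t" "1 < p"
    and fin: "(\<integral>\<^sup>+t. ennreal (K_mean e0 e1 f t powr (2 * p)) \<partial>lborel) < \<infinity>"
  shows "summable (\<lambda>k. 2 ^ k * (K_functional e0 e1 (t / 2 ^ k) f)\<^sup>2)"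
proof -
  obtain i where i: "(\<integral>\<^sup>+t. ennreal (K_mean e0 e1 f t powr (2 * p)) \<partial>lborel) = ennreal i" "0 \<le> i"
    using fin by (cases "\<integral>\<^sup>+t. ennreal (K_mean e0 e1 f t powr (2 * p)) \<partial>lborel") auto
  \<comment> \<open>The decay of \<open>K_mean\<close> turns the series into a geometric one of ratio \<open>r\<close>.\<close>
  define r :: real where "r = 2 powr (1 / p - 1)"
  have r: "0 < r" "r < 1" using powr_less_mono[of "1/p - 1" 0 2] assms(3) by (simp_all add: r_def)
  have "summable (\<lambda>k. t\<^sup>2 * (i / t) powr (1 / p) * r ^ k)"
    using r by (intro summable_mult summable_geometric) simp
  then show ?thesis
  proof (rule summable_comparison_test'[where N = 0])
    fix k :: nat
    let ?s = "t / 2 ^ k"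
    have "0 < ?s" using assms(2) by simp
    have "(K_mean e0 e1 f ?s)\<^sup>2 \<le> ((i / ?s) powr (1 / (2 * p)))\<^sup>2"
      using assms(3) by (intro power_mono K_mean_decay[OF assms(1) \<open>0 < ?s\<close> _ i] K_mean_nonneg[OF assms(1)]) simp
    also have "\<dots> = (i / ?s) powr (1 / p)"
      by (simp add: power2_eq_square powr_add[symmetric])
    also have "\<dots> = (i / t) powr (1 / p) * (2 ^ k) powr (1 / p)"
      using i(2) assms(2) by (simp add: powr_mult[symmetric] mult.commute)
    finally have le: "(K_mean e0 e1 f ?s)\<^sup>2 \<le> (i / t) powr (1 / p) * (2 ^ k) powr (1 / p)" .
    have rk: "r ^ k = (2 ^ k) powr (1 / p) / 2 ^ k"
      by (simp add: r_def powr_realpow[symmetric] powr_powr powr_diff[symmetric] algebra_simps)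
    have "2 ^ k * (K_functional e0 e1 ?s f)\<^sup>2 = t\<^sup>2 / 2 ^ k * (K_mean e0 e1 f ?s)\<^sup>2"
      using assms(2) by (simp add: K_mean_def power2_eq_square field_simps)
    also have "\<dots> \<le> t\<^sup>2 / 2 ^ k * ((i / t) powr (1 / p) * (2 ^ k) powr (1 / p))"
      using le by (intro mult_left_mono) auto
    also have "\<dots> = t\<^sup>2 * (i / t) powr (1 / p) * r ^ k"
      unfolding rk by simp
    finally show "norm (2 ^ k * (K_functional e0 e1 ?s f)\<^sup>2) \<le> t\<^sup>2 * (i / t) powr (1 / p) * r ^ k"
      by simp
  qed
qed

section \<open>The product as a limit along adapted decompositions\<close>

lemma norm_lincomb_square:
  fixes x y :: "'z::real_normed_vector"
  shows "(norm (u *\<^sub>R x + v *\<^sub>R y))\<^sup>2 \<le> 2 * u\<^sup>2 * (norm x)\<^sup>2 + 2 * v\<^sup>2 * (norm y)\<^sup>2"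
proof -
  have "(norm (u *\<^sub>R x + v *\<^sub>R y))\<^sup>2 \<le> (\<bar>u\<bar> * norm x + \<bar>v\<bar> * norm y)\<^sup>2"
    using norm_triangle_ineq[of "u *\<^sub>R x" "v *\<^sub>R y"] by (intro power_mono) auto
  also have "\<dots> \<le> 2 * (\<bar>u\<bar> * norm x)\<^sup>2 + 2 * (\<bar>v\<bar> * norm y)\<^sup>2"
    using zero_le_power2[of "\<bar>u\<bar> * norm x - \<bar>v\<bar> * norm y"]
    by (simp add: power2_sum power2_diff)
  finally show ?thesis by (simp add: power_mult_distrib)
qed

lemma tendsto_scaleR_const:
  fixes F :: "nat \<Rightarrow> 'w::hausdorff_tvs"
  assumes "F \<longlonglongrightarrow> x"
  shows "(\<lambda>k. u *\<^sub>R F k) \<longlonglongrightarrow> u *\<^sub>R x"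
proof -
  have 1: "filterlim (\<lambda>k. (u, F k)) (nhds u \<times>\<^sub>F nhds x) sequentially"
    by (rule filterlim_Pair[OF tendsto_const assms])
  have "filterlim (\<lambda>k. fst (u, F k) *\<^sub>R snd (u, F k)) (nhds (u *\<^sub>R x)) sequentially"
    by (rule filterlim_compose[OF tendsto_scaleR_Pair 1])
  then show ?thesis by (simp only: fst_conv snd_conv)
qed

text \<open>
  In the model case \<open>e0\<close> embeds \<open>L\<^sup>\<infinity>\<close> and \<open>e1\<close> embeds \<open>L\<^sup>1\<close>: there is no bounded map on pairs from the
  second space, whose products leave the couple. Being restrictions of one \<open>B\<close>, the three maps agree on
  overlaps.
\<close>
locale bilinear_couple =
  fixes e0 :: "'a::banach \<Rightarrow> 'v::hausdorff_tvs"
    and e1 :: "'b::banach \<Rightarrow> 'v"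
    and B :: "'v \<Rightarrow> 'v \<Rightarrow> 'v"
    and b00 :: "'a \<Rightarrow> 'a \<Rightarrow> 'a"
    and b01 :: "'a \<Rightarrow> 'b \<Rightarrow> 'b"
    and b10 :: "'b \<Rightarrow> 'a \<Rightarrow> 'b"
  assumes couple: "compatible_couple e0 e1"
    and bilinear: "bounded_bilinear b00" "bounded_bilinear b01" "bounded_bilinear b10"
    and B00: "\<And>x y. B (e0 x) (e0 y) = e0 (b00 x y)"
    and B01: "\<And>x y. B (e0 x) (e1 y) = e1 (b01 x y)"
    and B10: "\<And>x y. B (e1 x) (e0 y) = e1 (b10 x y)"
begin

lemmas linear_e = compatible_coupleD(1,2)[OF couple]

lemmas e0_simps = linear_add[OF linear_e(1)] linear_diff[OF linear_e(1)]
  linear_scale[OF linear_e(1)] linear_0[OF linear_e(1)]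

lemmas e1_simps = linear_add[OF linear_e(2)] linear_diff[OF linear_e(2)]
  linear_scale[OF linear_e(2)] linear_0[OF linear_e(2)]

lemmas b_diff = bounded_bilinear.diff_left[OF bilinear(1)]  bounded_bilinear.diff_right[OF bilinear(1)]

lemma bilinear_bound:
  obtains M where "0 < M" "\<And>x y. norm (b00 x y) \<le> norm x * norm y * M"
    "\<And>x y. norm (b01 x y) \<le> norm x * norm y * M" "\<And>x y. norm (b10 x y) \<le> norm x * norm y * M"
proof -
  obtain M0 M1 M2 where M: "0 < M0" "0 < M1" "0 < M2"
    and m: "\<And>x y. norm (b00 x y) \<le> norm x * norm y * M0" "\<And>x y. norm (b01 x y) \<le> norm x * norm y * M1"
      "\<And>x y. norm (b10 x y) \<le> norm x * norm y * M2"
    using bounded_bilinear.pos_bounded[OF bilinear(1)] bounded_bilinear.pos_bounded[OF bilinear(2)]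
      bounded_bilinear.pos_bounded[OF bilinear(3)] by blast
  have enlarge: "z \<le> r * (M0 + M1 + M2)" if "z \<le> r * M'" "0 \<le> r" "M' \<in> {M0, M1, M2}" for z r M'
    using that M by (elim order_trans) (auto intro!: mult_left_mono)
  show ?thesis
    by (rule that[of "M0 + M1 + M2"]) (use M in \<open>auto intro!: enlarge m\<close>)
qed

text \<open>
  The index \<open>k\<close> belongs to the scale \<open>2 powr (- k)\<close>: the parts \<open>a k\<close> tend to \<open>0\<close>, the parts \<open>b k\<close> may blow
  up. The two weights are dual to each other, so that \<open>norm (a k) * norm (d k)\<close> is summable whenever
  \<open>a\<close> and \<open>d\<close> come from two adapted decompositions.
\<close>
definition adapted :: "'v \<Rightarrow> (nat \<Rightarrow> 'b) \<Rightarrow> (nat \<Rightarrow> 'a) \<Rightarrow> bool" where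
  "adapted f a b \<longleftrightarrow> (\<forall>k. f = e1 (a k) + e0 (b k)) \<and>
     summable (\<lambda>k. 2 ^ k * (norm (a k))\<^sup>2) \<and> summable (\<lambda>k. (norm (b k))\<^sup>2 / 2 ^ k)"

lemma adapted_decomp: "adapted f a b \<Longrightarrow> f = e1 (a k) + e0 (b k)"
  by (simp add: adapted_def)

lemma adapted_shift:
  assumes "adapted f a b"
  shows "adapted f (\<lambda>k. a (Suc k)) (\<lambda>k. b (Suc k))"
proof -
  have "summable (\<lambda>k. 2 ^ Suc k * (norm (a (Suc k)))\<^sup>2 / 2)"
    "summable (\<lambda>k. (norm (b (Suc k)))\<^sup>2 / 2 ^ Suc k * 2)"
    using assms unfolding adapted_def
    by (intro summable_divide summable_mult2, subst summable_Suc_iff; simp)+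
  then show ?thesis using assms by (simp add: adapted_def)
qed

lemma adapted_lincomb:
  assumes "adapted f a b" "adapted f' a' b'"
  shows "adapted (u *\<^sub>R f + v *\<^sub>R f') (\<lambda>k. u *\<^sub>R a k + v *\<^sub>R a' k) (\<lambda>k. u *\<^sub>R b k + v *\<^sub>R b' k)"
  unfolding adapted_def
proof (intro conjI allI)
  fix k
  show "u *\<^sub>R f + v *\<^sub>R f' = e1 (u *\<^sub>R a k + v *\<^sub>R a' k) + e0 (u *\<^sub>R b k + v *\<^sub>R b' k)"
    using adapted_decomp[OF assms(1), of k] adapted_decomp[OF assms(2), of k]
    by (simp add: e0_simps e1_simps algebra_simps)
next
  have "summable (\<lambda>k. 2 * u\<^sup>2 * (2 ^ k * (norm (a k))\<^sup>2) + 2 * v\<^sup>2 * (2 ^ k * (norm (a' k))\<^sup>2))"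
    using assms unfolding adapted_def by (intro summable_add summable_mult) auto
  then show "summable (\<lambda>k. 2 ^ k * (norm (u *\<^sub>R a k + v *\<^sub>R a' k))\<^sup>2)"
  proof (rule summable_comparison_test'[where N = 0])
    fix k
    show "norm (2 ^ k * (norm (u *\<^sub>R a k + v *\<^sub>R a' k))\<^sup>2)
      \<le> 2 * u\<^sup>2 * (2 ^ k * (norm (a k))\<^sup>2) + 2 * v\<^sup>2 * (2 ^ k * (norm (a' k))\<^sup>2)"
      using mult_left_mono[OF norm_lincomb_square[of u "a k" v "a' k"], of "2 ^ k"]
      by (simp add: algebra_simps)
  qed
  have "summable (\<lambda>k. 2 * u\<^sup>2 * ((norm (b k))\<^sup>2 / 2 ^ k) + 2 * v\<^sup>2 * ((norm (b' k))\<^sup>2 / 2 ^ k))"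
    using assms unfolding adapted_def by (intro summable_add summable_mult) auto
  then show "summable (\<lambda>k. (norm (u *\<^sub>R b k + v *\<^sub>R b' k))\<^sup>2 / 2 ^ k)"
  proof (rule summable_comparison_test'[where N = 0])
    fix k
    show "norm ((norm (u *\<^sub>R b k + v *\<^sub>R b' k))\<^sup>2 / 2 ^ k)
      \<le> 2 * u\<^sup>2 * ((norm (b k))\<^sup>2 / 2 ^ k) + 2 * v\<^sup>2 * ((norm (b' k))\<^sup>2 / 2 ^ k)"
      using divide_right_mono[OF norm_lincomb_square[of u "b k" v "b' k"], of "2 ^ k"]
      by (simp add: add_divide_distrib)
  qed
qed

text \<open>
  Vectors of the space embedded by \<open>e0\<close> need no approximation, so on them the product constructed
  below is \<open>B\<close> itself.
\<close>
lemma adapted_const: "adapted (e0 x) (\<lambda>_. 0) (\<lambda>_. x)"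
proof -
  have "summable (\<lambda>k. (norm x)\<^sup>2 * (1 / 2) ^ k)"
    by (intro summable_mult summable_geometric) simp
  then show ?thesis by (simp add: adapted_def e1_simps power_one_over)
qed

text \<open>
  The arithmetic-geometric mean inequality with the dual weights.
\<close>
lemma adapted_product_summable:
  assumes "adapted f a b" "adapted g c d"
  shows "summable (\<lambda>k. norm (a k) * norm (d k))"
proof (rule summable_comparison_test'[where N = 0])
  show "summable (\<lambda>k. 2 ^ k * (norm (a k))\<^sup>2 + (norm (d k))\<^sup>2 / 2 ^ k)"
    using assms unfolding adapted_def by (intro summable_add) auto
  fix k
  have "2 * (norm (a k) * norm (d k)) \<le> 2 ^ k * (norm (a k))\<^sup>2 + (norm (d k))\<^sup>2 / 2 ^ k"
  proof -
    have "0 \<le> (2 ^ k * norm (a k) - norm (d k))\<^sup>2 / 2 ^ k" by simp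
    also have "\<dots> = 2 ^ k * (norm (a k))\<^sup>2 + (norm (d k))\<^sup>2 / 2 ^ k - 2 * (norm (a k) * norm (d k))"
      by (simp add: power2_diff field_simps power2_eq_square)
    finally show ?thesis by simp
  qed
  moreover have "0 \<le> norm (a k) * norm (d k)" by simp
  ultimately show "norm (norm (a k) * norm (d k)) \<le> 2 ^ k * (norm (a k))\<^sup>2 + (norm (d k))\<^sup>2 / 2 ^ k"
    unfolding real_norm_def by linarith
qed

text \<open>
  Although \<open>b00\<close> takes values in the space embedded by \<open>e0\<close>, the difference lies in the space embedded by
  \<open>e1\<close>: two decompositions of the same vector differ by an element of both spaces.
\<close>
lemma b00_difference:
  assumes "adapted f a b" "adapted f c d" "adapted g a' b'" "adapted g c' d'"
  shows "e0 (b00 (b k) (b' k)) - e0 (b00 (d k) (d' k)) =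
    e1 (b10 (c k - a k) (b' k) + b01 (d k) (c' k - a' k))"
proof -
  have 1: "e0 (b k - d k) = e1 (c k - a k)"
    using adapted_decomp[OF assms(1), of k] adapted_decomp[OF assms(2), of k]
    by (simp add: e0_simps e1_simps algebra_simps)
  have 2: "e0 (b' k - d' k) = e1 (c' k - a' k)"
    using adapted_decomp[OF assms(3), of k] adapted_decomp[OF assms(4), of k]
    by (simp add: e0_simps e1_simps algebra_simps)
  have "e0 (b00 (b k) (b' k)) - e0 (b00 (d k) (d' k)) =
      e0 (b00 (b k - d k) (b' k)) + e0 (b00 (d k) (b' k - d' k))"
    by (simp add: e0_simps b_diff)
  also have "\<dots> = e1 (b10 (c k - a k) (b' k)) + e1 (b01 (d k) (c' k - a' k))"
    by (simp only: B00[symmetric] B01[symmetric] B10[symmetric] 1 2)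
  finally show ?thesis by (simp add: e1_simps)
qed

lemma b00_difference_summable:
  assumes "adapted f a b" "adapted f c d" "adapted g a' b'" "adapted g c' d'"
  shows "summable (\<lambda>k. b10 (c k - a k) (b' k) + b01 (d k) (c' k - a' k))"
proof (rule summable_norm_cancel)
  obtain M where "0 < M" "\<And>x y. norm (b00 x y) \<le> norm x * norm y * M"
    and M: "\<And>x y. norm (b01 x y) \<le> norm x * norm y * M" "\<And>x y. norm (b10 x y) \<le> norm x * norm y * M"
    using bilinear_bound by blast
  have "adapted 0 (\<lambda>k. c k - a k) (\<lambda>k. d k - b k)" "adapted 0 (\<lambda>k. c' k - a' k) (\<lambda>k. d' k - b' k)"
    using adapted_lincomb[OF assms(2,1), of 1 "-1"] adapted_lincomb[OF assms(4,3), of 1 "-1"] by simp_all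
  then have "summable (\<lambda>k. norm (c k - a k) * norm (b' k) * M + norm (c' k - a' k) * norm (d k) * M)"
    using adapted_product_summable assms by (intro summable_add summable_mult2) blast+
  then show "summable (\<lambda>k. norm (b10 (c k - a k) (b' k) + b01 (d k) (c' k - a' k)))"
  proof (rule summable_comparison_test'[where N = 0])
    fix k
    show "norm (norm (b10 (c k - a k) (b' k) + b01 (d k) (c' k - a' k)))
      \<le> norm (c k - a k) * norm (b' k) * M + norm (c' k - a' k) * norm (d k) * M"
      using norm_triangle_ineq[of "b10 (c k - a k) (b' k)" "b01 (d k) (c' k - a' k)"]
        M(2)[of "c k - a k" "b' k"] M(1)[of "d k" "c' k - a' k"]
      by (simp add: mult.commute mult.left_commute)
  qed
qed

text \<open>
  Comparing an adapted decomposition with its own shift telescopes the sequence into a series that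
  converges absolutely in the space embedded by \<open>e1\<close>.
\<close>
lemma b00_converges:
  assumes "adapted f a b" "adapted g a' b'"
  shows "(\<lambda>k. e0 (b00 (b k) (b' k))) \<longlonglongrightarrow> e0 (b00 (b 0) (b' 0)) +
    e1 (\<Sum>k. b10 (a k - a (Suc k)) (b' (Suc k)) + b01 (b k) (a' k - a' (Suc k)))"
proof -
  let ?r = "\<lambda>k. b10 (a k - a (Suc k)) (b' (Suc k)) + b01 (b k) (a' k - a' (Suc k))"
  have step: "e0 (b00 (b (Suc k)) (b' (Suc k))) - e0 (b00 (b k) (b' k)) = e1 (?r k)" for k
    using b00_difference[OF adapted_shift[OF assms(1)] assms(1) adapted_shift[OF assms(2)] assms(2)] .
  have "summable ?r"
    using b00_difference_summable[OF adapted_shift[OF assms(1)] assms(1) adapted_shift[OF assms(2)] assms(2)] .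
  then have "(\<lambda>k. e1 (\<Sum>j<k. ?r j)) \<longlonglongrightarrow> e1 (suminf ?r)"
    by (intro isCont_tendsto_compose[OF compatible_couple_isCont(2)[OF couple]] summable_LIMSEQ)
  then have lim: "(\<lambda>k. e0 (b00 (b 0) (b' 0)) + e1 (\<Sum>j<k. ?r j)) \<longlonglongrightarrow> e0 (b00 (b 0) (b' 0)) + e1 (suminf ?r)"
    by (rule tendsto_add[OF tendsto_const])
  have partial: "e0 (b00 (b k) (b' k)) = e0 (b00 (b 0) (b' 0)) + e1 (\<Sum>j<k. ?r j)" for k
  proof (induction k)
    case 0
    show ?case by (simp add: e1_simps)
  next
    case (Suc k)
    have "e0 (b00 (b (Suc k)) (b' (Suc k))) = e0 (b00 (b k) (b' k)) + e1 (?r k)"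
      using step[of k] unfolding diff_eq_eq by (simp only: add.commute)
    also have "\<dots> = e0 (b00 (b 0) (b' 0)) + e1 (\<Sum>j<Suc k. ?r j)"
      unfolding Suc.IH sum.lessThan_Suc e1_simps(1) by (simp only: add.assoc)
    finally show ?case .
  qed
  have "(\<lambda>k. e0 (b00 (b 0) (b' 0)) + e1 (\<Sum>j<k. ?r j)) = (\<lambda>k. e0 (b00 (b k) (b' k)))"
    by (rule ext) (rule partial[symmetric])
  from lim[unfolded this] show ?thesis .
qed

text \<open>
  The extension of \<open>B\<close>; the next lemma justifies the definite description.
\<close>
definition product :: "'v \<Rightarrow> 'v \<Rightarrow> 'v" where
  "product f g = (THE v. \<exists>a b a' b'. adapted f a b \<and> adapted g a' b' \<and>
     (\<lambda>k. e0 (b00 (b k) (b' k))) \<longlonglongrightarrow> v)"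

text \<open>
  The comparison series of two adapted decompositions is summable, so its terms tend to \<open>0\<close>.
\<close>
lemma b00_limit_unique:
  assumes "adapted f a b" "adapted g a' b'" "(\<lambda>k. e0 (b00 (b k) (b' k))) \<longlonglongrightarrow> v"
    and "adapted f c d" "adapted g c' d'" "(\<lambda>k. e0 (b00 (d k) (d' k))) \<longlonglongrightarrow> w"
  shows "v = w"
proof -
  let ?r = "\<lambda>k. b10 (c k - a k) (b' k) + b01 (d k) (c' k - a' k)"
  have "?r \<longlonglongrightarrow> 0"
    by (rule summable_LIMSEQ_zero[OF b00_difference_summable[OF assms(1,4,2,5)]])
  then have "(\<lambda>k. e1 (?r k)) \<longlonglongrightarrow> e1 0"
    by (rule isCont_tendsto_compose[OF compatible_couple_isCont(2)[OF couple]])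
  then have "(\<lambda>k. e0 (b00 (b k) (b' k)) - e0 (b00 (d k) (d' k))) \<longlonglongrightarrow> 0"
    unfolding b00_difference[OF assms(1,4,2,5)] e1_simps(4) .
  moreover have "(\<lambda>k. e0 (b00 (b k) (b' k)) - e0 (b00 (d k) (d' k))) \<longlonglongrightarrow> v - w"
    by (rule tendsto_diff[OF assms(3,6)])
  ultimately have "v - w = 0" using LIMSEQ_unique by blast
  then show ?thesis by simp
qed

lemma product_eqI:
  assumes "adapted f a b" "adapted g a' b'" "(\<lambda>k. e0 (b00 (b k) (b' k))) \<longlonglongrightarrow> v"
  shows "product f g = v"
  unfolding product_def
proof (rule the_equality)
  show "\<exists>a b a' b'. adapted f a b \<and> adapted g a' b' \<and> (\<lambda>k. e0 (b00 (b k) (b' k))) \<longlonglongrightarrow> v"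
    using assms by blast
next
  fix w
  assume "\<exists>a b a' b'. adapted f a b \<and> adapted g a' b' \<and> (\<lambda>k. e0 (b00 (b k) (b' k))) \<longlonglongrightarrow> w"
  then obtain c d c' d' where "adapted f c d" "adapted g c' d'" "(\<lambda>k. e0 (b00 (d k) (d' k))) \<longlonglongrightarrow> w"
    by blast
  from b00_limit_unique[OF this assms] show "w = v" .
qed

lemma product_tendsto:
  assumes "adapted f a b" "adapted g a' b'"
  shows "(\<lambda>k. e0 (b00 (b k) (b' k))) \<longlonglongrightarrow> product f g"
proof -
  obtain v where v: "(\<lambda>k. e0 (b00 (b k) (b' k))) \<longlonglongrightarrow> v"
    using b00_converges[OF assms] by (rule that)
  have "product f g = v" by (rule product_eqI[OF assms v])
  with v show ?thesis by blast
qed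

lemma product_e0: "product (e0 x) (e0 y) = B (e0 x) (e0 y)"
proof -
  have "product (e0 x) (e0 y) = e0 (b00 x y)"
    by (rule product_eqI[OF adapted_const adapted_const]) (rule tendsto_const)
  then show ?thesis by (simp only: B00)
qed

lemma product_lincomb_left:
  assumes "adapted f a b" "adapted f' a' b'" "adapted g c d"
  shows "product (u *\<^sub>R f + v *\<^sub>R f') g = u *\<^sub>R product f g + v *\<^sub>R product f' g"
proof (rule product_eqI[OF adapted_lincomb[OF assms(1,2)] assms(3)])
  show "(\<lambda>k. e0 (b00 (u *\<^sub>R b k + v *\<^sub>R b' k) (d k))) \<longlonglongrightarrow> u *\<^sub>R product f g + v *\<^sub>R product f' g"
    unfolding bounded_bilinear.add_left[OF bilinear(1)] bounded_bilinear.scaleR_left[OF bilinear(1)] e0_simps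
    by (rule tendsto_add[OF tendsto_scaleR_const[OF product_tendsto[OF assms(1,3)]]
          tendsto_scaleR_const[OF product_tendsto[OF assms(2,3)]]])
qed

lemma product_lincomb_right:
  assumes "adapted f a b" "adapted g c d" "adapted g' c' d'"
  shows "product f (u *\<^sub>R g + v *\<^sub>R g') = u *\<^sub>R product f g + v *\<^sub>R product f g'"
proof (rule product_eqI[OF assms(1) adapted_lincomb[OF assms(2,3)]])
  show "(\<lambda>k. e0 (b00 (b k) (u *\<^sub>R d k + v *\<^sub>R d' k))) \<longlonglongrightarrow> u *\<^sub>R product f g + v *\<^sub>R product f g'"
    unfolding bounded_bilinear.add_right[OF bilinear(1)] bounded_bilinear.scaleR_right[OF bilinear(1)] e0_simps
    by (rule tendsto_add[OF tendsto_scaleR_const[OF product_tendsto[OF assms(1,2)]]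
          tendsto_scaleR_const[OF product_tendsto[OF assms(1,3)]]])
qed

section \<open>Boundedness of the product\<close>

lemma adapted_exists:
  assumes "f \<in> couple_sum e1 e0" "0 < t"
    and "summable (\<lambda>k. 2 ^ k * (K_functional e1 e0 (t / 2 ^ k) f)\<^sup>2)"
  obtains a b where "adapted f a b" "\<And>k. norm (a k) \<le> 2 * K_functional e1 e0 (t / 2 ^ k) f"
    "\<And>k. norm (b k) \<le> 2 ^ k / t * (2 * K_functional e1 e0 (t / 2 ^ k) f)"
proof -
  let ?K = "\<lambda>k. K_functional e1 e0 (t / 2 ^ k) f"
  have "compatible_couple e1 e0" using couple by (simp add: compatible_couple_def)
  then have "\<exists>z. f = e1 (fst z) + e0 (snd z) \<and> norm (fst z) \<le> 2 * ?K k \<and> t / 2 ^ k * norm (snd z) \<le> 2 * ?K k" for k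
    using K_functional_near_minimiser[OF _ assms(1), of "t / 2 ^ k"] assms(2)
    by (metis divide_pos_pos fst_conv snd_conv zero_less_numeral zero_less_power)
  then obtain z where z: "\<And>k. f = e1 (fst (z k)) + e0 (snd (z k))" "\<And>k. norm (fst (z k)) \<le> 2 * ?K k"
      "\<And>k. t / 2 ^ k * norm (snd (z k)) \<le> 2 * ?K k"
    by metis
  have b: "norm (snd (z k)) \<le> 2 ^ k / t * (2 * ?K k)" for k
    using z(3)[of k] assms(2) by (simp add: field_simps)
  have "summable (\<lambda>k. 4 * (2 ^ k * (?K k)\<^sup>2))" by (rule summable_mult[OF assms(3)])
  then have "summable (\<lambda>k. 2 ^ k * (norm (fst (z k)))\<^sup>2)"
  proof (rule summable_comparison_test'[where N = 0])
    fix k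
    show "norm (2 ^ k * (norm (fst (z k)))\<^sup>2) \<le> 4 * (2 ^ k * (?K k)\<^sup>2)"
      using power_mono[OF z(2)[of k], of 2] by (simp add: power_mult_distrib)
  qed
  moreover have "summable (\<lambda>k. 4 / t\<^sup>2 * (2 ^ k * (?K k)\<^sup>2))" by (rule summable_mult[OF assms(3)])
  then have "summable (\<lambda>k. (norm (snd (z k)))\<^sup>2 / 2 ^ k)"
  proof (rule summable_comparison_test'[where N = 0])
    fix k
    have "(norm (snd (z k)))\<^sup>2 / 2 ^ k \<le> (2 ^ k / t * (2 * ?K k))\<^sup>2 / 2 ^ k"
      using power_mono[OF b[of k], of 2] by (intro divide_right_mono) auto
    also have "\<dots> = 4 / t\<^sup>2 * (2 ^ k * (?K k)\<^sup>2)"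
      by (simp add: power2_eq_square)
    finally show "norm ((norm (snd (z k)))\<^sup>2 / 2 ^ k) \<le> 4 / t\<^sup>2 * (2 ^ k * (?K k)\<^sup>2)" by simp
  qed
  ultimately have "adapted f (\<lambda>k. fst (z k)) (\<lambda>k. snd (z k))"
    unfolding adapted_def using z(1) by blast
  then show ?thesis using that z(2) b by blast
qed

text \<open>
  O'Neil's inequality. The limit splits into its zeroth term, estimated in the space embedded by \<open>e0\<close>,
  and the telescoping series, estimated in the space embedded by \<open>e1\<close>. The zeroth term contributes
  \<open>4 * M / t\<close> and the series \<open>24 * M / t\<close>, from the factor \<open>2\<close> in near-minimisers and the
  passage between consecutive scales.
\<close>
lemma product_K_functional_le:
  assumes M: "0 < M" "\<And>x y. norm (b00 x y) \<le> norm x * norm y * M"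
    "\<And>x y. norm (b01 x y) \<le> norm x * norm y * M" "\<And>x y. norm (b10 x y) \<le> norm x * norm y * M"
    and f: "f \<in> couple_sum e1 e0" "summable (\<lambda>k. 2 ^ k * (K_functional e1 e0 (t / 2 ^ k) f)\<^sup>2)"
    and g: "g \<in> couple_sum e1 e0" "summable (\<lambda>k. 2 ^ k * (K_functional e1 e0 (t / 2 ^ k) g)\<^sup>2)"
    and t: "0 < t"
  shows "product f g \<in> couple_sum e1 e0"
    and "summable (\<lambda>k. 2 ^ k * (K_functional e1 e0 (t / 2 ^ k) f * K_functional e1 e0 (t / 2 ^ k) g))"
    and "K_functional e1 e0 t (product f g) \<le> 28 * M / t *
      (\<Sum>k. 2 ^ k * (K_functional e1 e0 (t / 2 ^ k) f * K_functional e1 e0 (t / 2 ^ k) g))"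
proof -
  let ?K = "\<lambda>k. K_functional e1 e0 (t / 2 ^ k) f" and ?L = "\<lambda>k. K_functional e1 e0 (t / 2 ^ k) g"
  obtain a b where a: "adapted f a b" "\<And>k. norm (a k) \<le> 2 * ?K k" "\<And>k. norm (b k) \<le> 2 ^ k / t * (2 * ?K k)"
    using adapted_exists[OF f(1) t f(2)] by blast
  obtain a' b' where a': "adapted g a' b'" "\<And>k. norm (a' k) \<le> 2 * ?L k" "\<And>k. norm (b' k) \<le> 2 ^ k / t * (2 * ?L k)"
    using adapted_exists[OF g(1) t g(2)] by blast
  let ?r = "\<lambda>k. b10 (a k - a (Suc k)) (b' (Suc k)) + b01 (b k) (a' k - a' (Suc k))"
  let ?s = "\<lambda>k. 2 ^ k * (?K k * ?L k)"
  have eq: "product f g = e1 (suminf ?r) + e0 (b00 (b 0) (b' 0))"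
    using product_eqI[OF a(1) a'(1) b00_converges[OF a(1) a'(1)]] by (simp only: add.commute)
  then show "product f g \<in> couple_sum e1 e0" unfolding couple_sum_def by blast
  have nonneg: "0 \<le> ?K k" "0 \<le> ?L k" for k
    using t by (auto intro!: K_functional_nonneg f(1) g(1))
  have dec: "?K (Suc k) \<le> ?K k" "?L (Suc k) \<le> ?L k" for k
    using t by (auto intro!: K_functional_mono f(1) g(1) divide_left_mono)
  show summable: "summable ?s"
  proof (rule summable_comparison_test'[where N = 0])
    show "summable (\<lambda>k. 2 ^ k * (?K k)\<^sup>2 + 2 ^ k * (?L k)\<^sup>2)" by (rule summable_add[OF f(2) g(2)])
    fix k
    have "?K k * ?L k \<le> (?K k)\<^sup>2 + (?L k)\<^sup>2"
      using sum_squares_bound[of "?K k" "?L k"] mult_nonneg_nonneg[OF nonneg(1)[of k] nonneg(2)[of k]]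
      by linarith
    then have "2 ^ k * (?K k * ?L k) \<le> 2 ^ k * ((?K k)\<^sup>2 + (?L k)\<^sup>2)" by (rule mult_left_mono) simp
    then show "norm (?s k) \<le> 2 ^ k * (?K k)\<^sup>2 + 2 ^ k * (?L k)\<^sup>2"
      using nonneg by (simp add: distrib_left)
  qed
  have r_le: "norm (?r k) \<le> 24 * M / t * ?s k" for k
  proof -
    have da: "norm (a k - a (Suc k)) \<le> 4 * ?K k"
      using norm_triangle_ineq4[of "a k" "a (Suc k)"] a(2)[of k] a(2)[of "Suc k"] dec(1)[of k] by linarith
    have da': "norm (a' k - a' (Suc k)) \<le> 4 * ?L k"
      using norm_triangle_ineq4[of "a' k" "a' (Suc k)"] a'(2)[of k] a'(2)[of "Suc k"] dec(2)[of k] by linarith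
    have b': "norm (b' (Suc k)) \<le> 4 * 2 ^ k / t * ?L k"
    proof -
      have "norm (b' (Suc k)) \<le> 2 ^ Suc k / t * (2 * ?L (Suc k))" by (rule a'(3))
      also have "\<dots> \<le> 2 ^ Suc k / t * (2 * ?L k)" using dec t by (intro mult_left_mono) auto
      finally show ?thesis by simp
    qed
    have "norm (?r k) \<le> norm (a k - a (Suc k)) * norm (b' (Suc k)) * M + norm (b k) * norm (a' k - a' (Suc k)) * M"
      using norm_triangle_ineq[of "b10 (a k - a (Suc k)) (b' (Suc k))" "b01 (b k) (a' k - a' (Suc k))"]
        M(4)[of "a k - a (Suc k)" "b' (Suc k)"] M(3)[of "b k" "a' k - a' (Suc k)"] by linarith
    also have "\<dots> \<le> 4 * ?K k * (4 * 2 ^ k / t * ?L k) * M + 2 ^ k / t * (2 * ?K k) * (4 * ?L k) * M"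
      using da da' b' a(3)[of k] M(1) nonneg t by (intro add_mono mult_right_mono mult_mono) auto
    also have "\<dots> = 24 * M / t * ?s k" using t by (simp add: field_simps)
    finally show ?thesis .
  qed
  have sr: "summable (\<lambda>k. norm (?r k))"
    by (rule summable_comparison_test'[OF summable_mult[OF summable, of "24 * M / t"], of 0]) (use r_le in simp)
  have "norm (suminf ?r) \<le> (\<Sum>k. norm (?r k))" by (rule summable_norm[OF sr])
  also have "\<dots> \<le> (\<Sum>k. 24 * M / t * ?s k)"
    by (rule suminf_le[OF r_le sr summable_mult[OF summable]])
  also have "\<dots> = 24 * M / t * suminf ?s" by (rule suminf_mult[OF summable])
  finally have n1: "norm (suminf ?r) \<le> 24 * M / t * suminf ?s" .
  have "norm (b00 (b 0) (b' 0)) \<le> norm (b 0) * norm (b' 0) * M" by (rule M(2))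
  also have "\<dots> \<le> (2 ^ 0 / t * (2 * ?K 0)) * (2 ^ 0 / t * (2 * ?L 0)) * M"
    using a(3)[of 0] a'(3)[of 0] nonneg[of 0] t M(1) by (intro mult_right_mono mult_mono) auto
  finally have "t * norm (b00 (b 0) (b' 0)) \<le> t * ((2 ^ 0 / t * (2 * ?K 0)) * (2 ^ 0 / t * (2 * ?L 0)) * M)"
    using t by (intro mult_left_mono) auto
  also have "\<dots> = 4 * M / t * ?s 0" using t by (simp add: field_simps)
  also have "\<dots> \<le> 4 * M / t * suminf ?s"
    using sum_le_suminf[OF summable, of "{0}"] nonneg M(1) t by (intro mult_left_mono) auto
  finally have n2: "t * norm (b00 (b 0) (b' 0)) \<le> 4 * M / t * suminf ?s" .
  have "K_functional e1 e0 t (product f g) \<le> norm (suminf ?r) + t * norm (b00 (b 0) (b' 0))"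
    using t by (intro K_functional_le eq) simp
  also have "\<dots> \<le> 24 * M / t * suminf ?s + 4 * M / t * suminf ?s" using n1 n2 by (rule add_mono)
  also have "\<dots> = 28 * M / t * suminf ?s" using t by (simp add: field_simps)
  finally show "K_functional e1 e0 t (product f g) \<le> 28 * M / t * suminf ?s" .
qed

lemma product_K_mean_le:
  assumes M: "0 < M" "\<And>x y. norm (b00 x y) \<le> norm x * norm y * M"
    "\<And>x y. norm (b01 x y) \<le> norm x * norm y * M" "\<And>x y. norm (b10 x y) \<le> norm x * norm y * M"
    and f: "f \<in> couple_sum e1 e0" "\<And>t. 0 < t \<Longrightarrow> summable (\<lambda>k. 2 ^ k * (K_functional e1 e0 (t / 2 ^ k) f)\<^sup>2)"
    and g: "g \<in> couple_sum e1 e0" "\<And>t. 0 < t \<Longrightarrow> summable (\<lambda>k. 2 ^ k * (K_functional e1 e0 (t / 2 ^ k) g)\<^sup>2)"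
  shows "K_mean e1 e0 (product f g) t \<le> 28 * M *
    (\<Sum>k. K_mean e1 e0 f (t / 2 ^ k) * K_mean e1 e0 g (t / 2 ^ k) / 2 ^ k)"
proof (cases "0 < t")
  case True
  let ?s = "\<lambda>k. 2 ^ k * (K_functional e1 e0 (t / 2 ^ k) f * K_functional e1 e0 (t / 2 ^ k) g)"
  have summand: "K_mean e1 e0 f (t / 2 ^ k) * K_mean e1 e0 g (t / 2 ^ k) / 2 ^ k = 1 / t\<^sup>2 * ?s k" for k
    using True by (simp add: K_mean_def power2_eq_square field_simps)
  have "suminf (\<lambda>k. 1 / t\<^sup>2 * ?s k) = 1 / t\<^sup>2 * suminf ?s"
    by (rule suminf_mult[OF product_K_functional_le(2)[OF M f(1) f(2)[OF True] g(1) g(2)[OF True] True]])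
  moreover have "K_mean e1 e0 (product f g) t \<le> 28 * M / t * suminf ?s / t"
    using divide_right_mono[OF product_K_functional_le(3)[OF M f(1) f(2)[OF True] g(1) g(2)[OF True] True], of t]
      True by (simp add: K_mean_def)
  moreover have "28 * M / t * suminf ?s / t = 28 * M * (1 / t\<^sup>2 * suminf ?s)"
    using True by (simp add: power2_eq_square)
  ultimately show ?thesis unfolding summand by (simp only:)
next
  case False
  then show ?thesis by (simp add: K_mean_def not_less zero_less_divide_iff)
qed

text \<open>
  O'Neil's inequality bounds \<open>K_mean\<close> of the product by dyadic averages of the product of the two
  \<open>K_mean\<close>'s; the Hardy and Cauchy--Schwarz inequalities do the rest.
\<close>
lemma product_norm_bound:
  assumes p: "1 < p"
  shows "\<exists>M\<ge>0. \<forall>f\<in>interp_space e1 e0 (1 - 1 / (2 * p)) (2 * p).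
    \<forall>g\<in>interp_space e1 e0 (1 - 1 / (2 * p)) (2 * p).
      product f g \<in> interp_space e1 e0 (1 - 1 / p) p \<and>
      interp_norm e1 e0 (1 - 1 / p) p (product f g) \<le> ennreal M *
        interp_norm e1 e0 (1 - 1 / (2 * p)) (2 * p) f * interp_norm e1 e0 (1 - 1 / (2 * p)) (2 * p) g"
proof -
  obtain M where M: "0 < M" "\<And>x y. norm (b00 x y) \<le> norm x * norm y * M"
    "\<And>x y. norm (b01 x y) \<le> norm x * norm y * M" "\<And>x y. norm (b10 x y) \<le> norm x * norm y * M"
    using bilinear_bound by blast
  have "0 < 28 * M" using M(1) by simp
  from dyadic_average_integral_le[OF p this]
  obtain D where D: "0 \<le> D" "\<And>F \<psi> :: real \<Rightarrow> real. \<psi> \<in> borel_measurable borel \<Longrightarrow> (\<And>t. 0 \<le> \<psi> t) \<Longrightarrow>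
    (\<And>t. 0 \<le> F t \<and> F t \<le> 28 * M * (\<Sum>k. \<psi> (t / 2 ^ k) / 2 ^ k)) \<Longrightarrow>
    (\<integral>\<^sup>+t. ennreal (F t powr p) \<partial>lborel) \<le> ennreal D * (\<integral>\<^sup>+t. ennreal (\<psi> t powr p) \<partial>lborel)"
    by blast
  have "0 < p" "0 < 2 * p" using p by auto
  have "product f g \<in> interp_space e1 e0 (1 - 1 / p) p \<and>
      interp_norm e1 e0 (1 - 1 / p) p (product f g) \<le> ennreal (D powr (1 / p)) *
        interp_norm e1 e0 (1 - 1 / (2 * p)) (2 * p) f * interp_norm e1 e0 (1 - 1 / (2 * p)) (2 * p) g"
    if f: "f \<in> interp_space e1 e0 (1 - 1 / (2 * p)) (2 * p)"
      and g: "g \<in> interp_space e1 e0 (1 - 1 / (2 * p)) (2 * p)" for f g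
  proof -
    let ?\<phi> = "K_mean e1 e0 f" and ?\<psi> = "K_mean e1 e0 g" and ?F = "K_mean e1 e0 (product f g)"
    obtain i where i: "f \<in> couple_sum e1 e0" "0 \<le> i"
        "(\<integral>\<^sup>+t. ennreal (?\<phi> t powr (2 * p)) \<partial>lborel) = ennreal i"
        "interp_norm e1 e0 (1 - 1 / (2 * p)) (2 * p) f = ennreal (i powr (1 / (2 * p)))"
      using interp_spaceE[OF f \<open>0 < 2 * p\<close>] by blast
    obtain j where j: "g \<in> couple_sum e1 e0" "0 \<le> j"
        "(\<integral>\<^sup>+t. ennreal (?\<psi> t powr (2 * p)) \<partial>lborel) = ennreal j"
        "interp_norm e1 e0 (1 - 1 / (2 * p)) (2 * p) g = ennreal (j powr (1 / (2 * p)))"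
      using interp_spaceE[OF g \<open>0 < 2 * p\<close>] by blast
    have sf: "summable (\<lambda>k. 2 ^ k * (K_functional e1 e0 (t / 2 ^ k) f)\<^sup>2)"
      and sg: "summable (\<lambda>k. 2 ^ k * (K_functional e1 e0 (t / 2 ^ k) g)\<^sup>2)" if "0 < t" for t
      using K_functional_dyadic_summable[OF i(1) that p] K_functional_dyadic_summable[OF j(1) that p]
      unfolding i(3) j(3) by simp_all
    have sum: "product f g \<in> couple_sum e1 e0"
      by (rule product_K_functional_le(1)[OF M i(1) sf j(1) sg]) (rule zero_less_one)+
    note K_mean_measurable[OF i(1), measurable] K_mean_measurable[OF j(1), measurable]
    let ?P = "\<integral>\<^sup>+t. ennreal ((?\<phi> t * ?\<psi> t) powr p) \<partial>lborel"
    have "(\<integral>\<^sup>+t. ennreal (?F t powr p) \<partial>lborel) \<le> ennreal D * ?P"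
    proof (rule D(2))
      show "(\<lambda>t. ?\<phi> t * ?\<psi> t) \<in> borel_measurable borel" by measurable
      show "0 \<le> ?\<phi> t * ?\<psi> t" for t using K_mean_nonneg i(1) j(1) by (intro mult_nonneg_nonneg)
      show "0 \<le> ?F t \<and> ?F t \<le> 28 * M * (\<Sum>k. ?\<phi> (t / 2 ^ k) * ?\<psi> (t / 2 ^ k) / 2 ^ k)" for t
        using product_K_mean_le[OF M i(1) sf j(1) sg] K_mean_nonneg[OF sum] by blast
    qed
    also have "?P \<le> ennreal (sqrt (i * j))"
    proof -
      have P: "?P\<^sup>2 \<le> ennreal (i * j)"
        using integral_product_le[OF K_mean_measurable[OF i(1)] K_mean_measurable[OF j(1)]
            K_mean_nonneg[OF i(1)] K_mean_nonneg[OF j(1)], of p] i(2) j(2)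
        unfolding i(3) j(3) by (simp add: ennreal_mult)
      then have "?P \<noteq> \<infinity>" by (auto simp: power2_eq_square ennreal_mult_eq_top_iff top_unique)
      then have r: "?P = ennreal (enn2real ?P)" by (simp add: less_top)
      have "ennreal ((enn2real ?P)\<^sup>2) \<le> ennreal (i * j)"
        using P by (subst (asm) r) (simp add: ennreal_power)
      then have "(enn2real ?P)\<^sup>2 \<le> i * j" using i(2) j(2) by simp
      then have "enn2real ?P \<le> sqrt (i * j)" by (rule real_le_rsqrt)
      then show ?thesis by (subst r) (rule ennreal_leI)
    qed
    finally have "(\<integral>\<^sup>+t. ennreal (?F t powr p) \<partial>lborel) \<le> ennreal (D * sqrt (i * j))"
      using D(1) i(2) j(2) by (simp add: ennreal_mult mult_left_mono)
    note le = this
    then have X: "product f g \<in> interp_space e1 e0 (1 - 1 / p) p"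
      unfolding interp_space_iff[OF \<open>0 < p\<close>] using sum order_le_less_trans by fastforce
    obtain h where h: "0 \<le> h" "(\<integral>\<^sup>+t. ennreal (?F t powr p) \<partial>lborel) = ennreal h"
        "interp_norm e1 e0 (1 - 1 / p) p (product f g) = ennreal (h powr (1 / p))"
      using interp_spaceE[OF X \<open>0 < p\<close>] by blast
    have "h \<le> D * sqrt (i * j)" using le D(1) i(2) j(2) unfolding h(2) by simp
    then have "h powr (1 / p) \<le> (D * sqrt (i * j)) powr (1 / p)"
      using h(1) p by (intro powr_mono2) auto
    also have "\<dots> = D powr (1 / p) * i powr (1 / (2 * p)) * j powr (1 / (2 * p))"
      using D(1) i(2) j(2) by (simp add: powr_mult powr_powr powr_half_sqrt[symmetric])
    finally have "interp_norm e1 e0 (1 - 1 / p) p (product f g) \<le>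
        ennreal (D powr (1 / p) * i powr (1 / (2 * p)) * j powr (1 / (2 * p)))"
      unfolding h(3) by (rule ennreal_leI)
    also have "\<dots> = ennreal (D powr (1 / p)) *
        interp_norm e1 e0 (1 - 1 / (2 * p)) (2 * p) f * interp_norm e1 e0 (1 - 1 / (2 * p)) (2 * p) g"
      unfolding i(4) j(4) by (simp add: ennreal_mult)
    finally show ?thesis using X by blast
  qed
  moreover have "0 \<le> D powr (1 / p)" by simp
  ultimately show ?thesis by blast
qed

lemma product_bounded_bilinear_on:
  assumes p: "1 < p"
  shows "bounded_bilinear_on
    (interp_space e1 e0 (1 - 1 / (2 * p)) (2 * p)) (interp_norm e1 e0 (1 - 1 / (2 * p)) (2 * p))
    (interp_space e1 e0 (1 - 1 / p) p) (interp_norm e1 e0 (1 - 1 / p) p) product"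
proof -
  let ?X = "interp_space e1 e0 (1 - 1 / (2 * p)) (2 * p)"
  have "0 < 2 * p" using p by simp
  have ex: "\<exists>a b. adapted f a b" if "f \<in> ?X" for f
  proof -
    have f: "f \<in> couple_sum e1 e0" "(\<integral>\<^sup>+t. ennreal (K_mean e1 e0 f t powr (2 * p)) \<partial>lborel) < \<infinity>"
      using that unfolding interp_space_iff[OF \<open>0 < 2 * p\<close>] by blast+
    show ?thesis
      by (rule adapted_exists[OF f(1) zero_less_one K_functional_dyadic_summable[OF f(1) zero_less_one p f(2)]])
        (intro exI)
  qed
  show ?thesis
    unfolding bounded_bilinear_on_def
  proof (intro conjI ballI allI)
    show "product f g \<in> interp_space e1 e0 (1 - 1 / p) p" if "f \<in> ?X" "g \<in> ?X" for f g
      using product_norm_bound[OF p] that by blast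
    show "product (a *\<^sub>R f + b *\<^sub>R f') g = a *\<^sub>R product f g + b *\<^sub>R product f' g"
      if X: "f \<in> ?X" "f' \<in> ?X" "g \<in> ?X" for f f' g a b
    proof -
      obtain a1 b1 a2 b2 a3 b3 where "adapted f a1 b1" "adapted f' a2 b2" "adapted g a3 b3"
        using ex[OF X(1)] ex[OF X(2)] ex[OF X(3)] by blast
      then show ?thesis by (rule product_lincomb_left)
    qed
    show "product f (a *\<^sub>R g + b *\<^sub>R g') = a *\<^sub>R product f g + b *\<^sub>R product f g'"
      if X: "f \<in> ?X" "g \<in> ?X" "g' \<in> ?X" for f g g' a b
    proof -
      obtain a1 b1 a2 b2 a3 b3 where "adapted f a1 b1" "adapted g a2 b2" "adapted g' a3 b3"
        using ex[OF X(1)] ex[OF X(2)] ex[OF X(3)] by blast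
      then show ?thesis by (rule product_lincomb_right)
    qed
    show "\<exists>M\<ge>0. \<forall>f\<in>?X. \<forall>g\<in>?X. interp_norm e1 e0 (1 - 1 / p) p (product f g) \<le> ennreal M *
        interp_norm e1 e0 (1 - 1 / (2 * p)) (2 * p) f * interp_norm e1 e0 (1 - 1 / (2 * p)) (2 * p) g"
      using product_norm_bound[OF p] by blast
  qed
qed

text \<open>
  The existence of one bounded extension, \<open>product\<close>, forces the chosen extension to be bounded too,
  with a constant of its own.
\<close>
lemma interp_extension_bounded:
  assumes p: "1 < p"
  shows "bounded_bilinear_on
    (interp_space e1 e0 (1 - 1 / (2 * p)) (2 * p)) (interp_norm e1 e0 (1 - 1 / (2 * p)) (2 * p))
    (interp_space e1 e0 (1 - 1 / p) p) (interp_norm e1 e0 (1 - 1 / p) p)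
    (interp_extension e1 e0 (1 - 1 / (2 * p)) (2 * p) (1 - 1 / p) p B)"
proof -
  define Q where "Q T \<longleftrightarrow> bounded_bilinear_on
      (interp_space e1 e0 (1 - 1 / (2 * p)) (2 * p)) (interp_norm e1 e0 (1 - 1 / (2 * p)) (2 * p))
      (interp_space e1 e0 (1 - 1 / p) p) (interp_norm e1 e0 (1 - 1 / p) p) T \<and>
      (\<forall>f\<in>couple_inter e1 e0. \<forall>g\<in>couple_inter e1 e0. T f g = B f g)" for T
  have "Q product"
    unfolding Q_def using product_bounded_bilinear_on[OF p] product_e0 by (auto simp: couple_inter_def)
  then have "Q (SOME T. Q T)" by (rule someI[of Q])
  then show ?thesis unfolding interp_extension_def Q_def by (rule conjunct1)
qed

end

section \<open>The product estimate\<close>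

theorem mainTheorem2:
  fixes e0 :: "'a::banach \<Rightarrow> 'v::hausdorff_tvs"
    and e1 :: "'b::banach \<Rightarrow> 'v"
    and B :: "'v \<Rightarrow> 'v \<Rightarrow> 'v"
    and p \<theta> :: real
  assumes "compatible_couple e0 e1"
    and "bounded_bilinear_between e0 e0 e0 B"
    and "bounded_bilinear_between e0 e1 e1 B"
    and "bounded_bilinear_between e1 e0 e1 B"
    and "1 < p"
    and "\<theta> = 1 / p"
  shows "\<exists>C>0. \<forall>f\<in>interp_space e1 e0 (1 - \<theta>) p. \<forall>g\<in>interp_space e1 e0 (1 - \<theta>) p.
           weak_limit_norm e1 e0 f < \<infinity> \<longrightarrow> weak_limit_norm e1 e0 g < \<infinity> \<longrightarrow>
           interp_norm e1 e0 (1 - \<theta>) p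
             (interp_extension e1 e0 (1 - \<theta> / 2) (2 * p) (1 - \<theta>) p B f g)
           \<le> ennreal C *
               (interp_norm e1 e0 (1 - \<theta>) p f * weak_limit_norm e1 e0 g +
                interp_norm e1 e0 (1 - \<theta>) p g * weak_limit_norm e1 e0 f)"
proof -
  obtain b00 b01 b10 where "bilinear_couple e0 e1 B b00 b01 b10"
    using assms(1-4) unfolding bounded_bilinear_between_def bilinear_couple_def by blast
  then interpret bilinear_couple e0 e1 B b00 b01 b10 .
  have \<theta>: "1 - \<theta> = 1 - 1 / p" "1 - \<theta> / 2 = 1 - 1 / (2 * p)" using assms(6) by simp_all
  let ?T = "interp_extension e1 e0 (1 - 1 / (2 * p)) (2 * p) (1 - 1 / p) p B"
  let ?N = "interp_norm e1 e0 (1 - 1 / p) p" and ?N2 = "interp_norm e1 e0 (1 - 1 / (2 * p)) (2 * p)"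
  have "0 < p" "1 \<le> p" using assms(5) by simp_all
  obtain M where M: "0 \<le> M" "\<And>f g. f \<in> interp_space e1 e0 (1 - 1 / (2 * p)) (2 * p) \<Longrightarrow>
      g \<in> interp_space e1 e0 (1 - 1 / (2 * p)) (2 * p) \<Longrightarrow> ?N (?T f g) \<le> ennreal M * ?N2 f * ?N2 g"
    using interp_extension_bounded[OF assms(5)] unfolding bounded_bilinear_on_def by blast
  define c where "c = (1 + 2 * (4 * p) powr (2 * p)) powr (1 / (2 * p))"
  have "0 \<le> c" by (simp add: c_def)
  \<comment> \<open>Adding \<open>1\<close> keeps \<open>C\<close> positive when \<open>M = 0\<close>.\<close>
  define C where "C = M * c\<^sup>2 + 1"
  have "0 < C" using M(1) by (simp add: C_def add_nonneg_pos)
  have "?N (?T f g) \<le> ennreal C * (?N f * weak_limit_norm e1 e0 g + ?N g * weak_limit_norm e1 e0 f)"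
    if f: "f \<in> interp_space e1 e0 (1 - 1 / p) p" "weak_limit_norm e1 e0 f < \<infinity>"
      and g: "g \<in> interp_space e1 e0 (1 - 1 / p) p" "weak_limit_norm e1 e0 g < \<infinity>" for f g
  proof -
    obtain n m where n: "?N f = ennreal n" "0 \<le> n" and m: "?N g = ennreal m" "0 \<le> m"
      using interp_spaceE[OF f(1) \<open>0 < p\<close>] interp_spaceE[OF g(1) \<open>0 < p\<close>] by (metis powr_ge_zero)
    obtain v w where v: "weak_limit_norm e1 e0 f = ennreal v" "0 \<le> v"
      and w: "weak_limit_norm e1 e0 g = ennreal w" "0 \<le> w"
      using f(2) g(2) by (metis ennreal_enn2real enn2real_nonneg infinity_ennreal_def)
    note F = interp_norm_weak_le[OF f(1) \<open>1 \<le> p\<close> n eq_refl[OF v(1)] v(2), folded c_def]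
    note G = interp_norm_weak_le[OF g(1) \<open>1 \<le> p\<close> m eq_refl[OF w(1)] w(2), folded c_def]
    have amgm: "sqrt (n * v) * sqrt (m * w) \<le> n * w + m * v"
    proof -
      have "sqrt (n * v) * sqrt (m * w) = sqrt ((n * w) * (m * v))"
        by (simp add: real_sqrt_mult)
      also have "\<dots> \<le> (n * w + m * v) / 2"
        using n(2) m(2) v(2) w(2) by (intro arith_geo_mean_sqrt) auto
      also have "\<dots> \<le> n * w + m * v" using n(2) m(2) v(2) w(2) by simp
      finally show ?thesis .
    qed
    have "?N (?T f g) \<le> ennreal M * ?N2 f * ?N2 g" by (rule M(2)[OF F(1) G(1)])
    also have "\<dots> \<le> ennreal M * ennreal (c * sqrt (n * v)) * ennreal (c * sqrt (m * w))"
      by (intro mult_mono F(2) G(2)) auto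
    also have "\<dots> = ennreal (M * (c * sqrt (n * v)) * (c * sqrt (m * w)))"
      using M(1) \<open>0 \<le> c\<close> n(2) m(2) v(2) w(2) by (simp add: ennreal_mult)
    also have "M * (c * sqrt (n * v)) * (c * sqrt (m * w)) = M * c\<^sup>2 * (sqrt (n * v) * sqrt (m * w))"
      by (simp add: power2_eq_square)
    also have "\<dots> \<le> ennreal (C * (n * w + m * v))"
      using amgm \<open>0 < C\<close> n(2) m(2) v(2) w(2) by (intro ennreal_leI mult_mono) (auto simp: C_def)
    also have "\<dots> = ennreal C * (?N f * weak_limit_norm e1 e0 g + ?N g * weak_limit_norm e1 e0 f)"
      unfolding n(1) m(1) v(1) w(1) using \<open>0 < C\<close> n(2) m(2) v(2) w(2)
      by (simp add: ennreal_mult ennreal_plus)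
    finally show ?thesis .
  qed
  with \<open>0 < C\<close> show ?thesis unfolding \<theta> by blast
qed

end
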